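(* Let $S$ be a generalized step-reinforced random walk on a countably infinite group $G$ with reinforcement parameter $\alpha\in[0,1)$ and step distribution $\mu$, where $\mu$ is a class function. Denote its law by $\mathbb{P}^{(\alpha)}$, so that under $\mathbb{P}^{(0)}$ (the case $\alpha=0$) the steps are i.i.d. with law $\mu$. Let $\varepsilon\in(0,1)$ and let $m\ge1$ be an integer such that $$\max_{x\in G}\mathbb{P}^{(0)}(S_n=x)\le\varepsilon\qquad\text{for all } n\ge m.$$ Then $$\max_{x\in G}\mathbb{P}^{(\alpha)}(S_n=x)\le\varepsilon+2e^{-(1-\alpha)n/18}\qquad\text{for all integers } n\ge\frac{8m}{1-\alpha}.$$
   Context: Generalized step-reinforced random walk (SRRW) on a discrete group $G$ with identity $e_G$. Let $\mu$ be a probability measure on $G$. Let $(g_n)_{n\ge1}$ be i.i.d. with law $\mu$, let $(\xi_n)_{n\ge2}$ be i.i.d. Bernoulli with parameter $\alpha\in[0,1]$, let $(u_n)_{n\ge2}$ be independent with $u_n$ uniform on $\{1,\ldots,n-1\}$, and let $(T_n)_{n\ge2}$ be random measurable transformations of $G$ (maps $G\to G$), with $(\omega,g)\mapsto T_n(\omega,g)$ jointly measurable. The four sequences $(g_n),(\xi_n),(u_n),(T_n)$ are mutually independent; no independence among the $T_n$ is required. Set $S_0=e_G$, $X_1=g_1$, and for $n\ge2$ set $X_n=g_n$ if $\xi_n=0$ and $X_n=T_n(X_{u_n})$ if $\xi_n=1$. Put $S_n=X_1\cdot X_2\cdots X_n$ for $n\ge1$. $\mu$ is a class function if $\mu(y^{-1}xy)=\mu(x)$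 for all $x,y\in G$. *)

theory Defs
  imports "HOL-Probability.Probability" "HOL-Algebra.Group"
begin

text \<open>The index type of the four mutually independent sources of randomness.\<close>

datatype source = Innovations | Coins | Memories | Transformations

text \<open>
  A probability measure \<open>\<mu>\<close> on the discrete group \<open>G\<close> is a measure on all subsets of the carrier.
  The coin \<open>\<xi> n\<close> is Boolean, with \<open>True\<close> standing for the value 1.
  As \<open>u n\<close> is measurable into \<open>count_space {1..<n}\<close>, it takes values in \<open>{1..<n}\<close> at every point
  of the probability space, so that the recursion for \<open>X\<close> determines \<open>X n\<close> for all \<open>n \<ge> 1\<close>.

  Each of the four sequences is regarded as one random element of a product space, and the
  \<open>\<sigma>\<close>-algebras generated by these random elements are assumed independent. The value of \<open>T n\<close> at a
  point of the probability space is an element of the product of copies of \<open>G\<close> indexed by \<open>G\<close>;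
  nothing is assumed about the joint law of the \<open>T n\<close>.
\<close>

locale srrw = prob_space M + group G
  for M :: "'w measure" and G :: "('a, 'b) monoid_scheme" (structure) +
  fixes \<mu> :: "'a measure"
    and \<alpha> :: real
    and g :: "nat \<Rightarrow> 'w \<Rightarrow> 'a"
    and \<xi> :: "nat \<Rightarrow> 'w \<Rightarrow> bool"
    and u :: "nat \<Rightarrow> 'w \<Rightarrow> nat"
    and T :: "nat \<Rightarrow> 'w \<Rightarrow> 'a \<Rightarrow> 'a"
    and X :: "nat \<Rightarrow> 'w \<Rightarrow> 'a"
  assumes prob_mu: "prob_space \<mu>"
    and sets_mu: "sets \<mu> = Pow (carrier G)"
    and alpha: "0 \<le> \<alpha>" "\<alpha> \<le> 1"
    and indep_g: "indep_vars (\<lambda>_. count_space (carrier G)) g {1..}"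
    and distr_g: "\<And>n. 1 \<le> n \<Longrightarrow> distr M (count_space (carrier G)) (g n) = \<mu>"
    and indep_xi: "indep_vars (\<lambda>_. count_space UNIV) \<xi> {2..}"
    and distr_xi: "\<And>n. 2 \<le> n \<Longrightarrow>
      distr M (count_space UNIV) (\<xi> n) = measure_pmf (bernoulli_pmf \<alpha>)"
    and indep_u: "indep_vars (\<lambda>n. count_space {1..<n}) u {2..}"
    and distr_u: "\<And>n. 2 \<le> n \<Longrightarrow>
      distr M (count_space {1..<n}) (u n) = uniform_count_measure {1..<n}"
    and measurable_T: "\<And>n. 2 \<le> n \<Longrightarrow>
      (\<lambda>(\<omega>, x). T n \<omega> x) \<in> M \<Otimes>\<^sub>M count_space (carrier G) \<rightarrow>\<^sub>M count_space (carrier G)"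
    and indep_sources: "indep_sets
      (\<lambda>s. case s of
          Innovations \<Rightarrow> sets (vimage_algebra (space M)
            (\<lambda>\<omega>. \<lambda>n\<in>{1..}. g n \<omega>) (\<Pi>\<^sub>M n\<in>{1..}. count_space (carrier G)))
        | Coins \<Rightarrow> sets (vimage_algebra (space M)
            (\<lambda>\<omega>. \<lambda>n\<in>{2..}. \<xi> n \<omega>) (\<Pi>\<^sub>M n\<in>{2..}. count_space UNIV))
        | Memories \<Rightarrow> sets (vimage_algebra (space M)
            (\<lambda>\<omega>. \<lambda>n\<in>{2..}. u n \<omega>) (\<Pi>\<^sub>M n\<in>{2..}. count_space {1..<n}))
        | Transformations \<Rightarrow> sets (vimage_algebra (space M)
            (\<lambda>\<omega>. \<lambda>n\<in>{2..}. \<lambda>x\<in>carrier G. T n \<omega> x)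
            (\<Pi>\<^sub>M n\<in>{2..}. \<Pi>\<^sub>M x\<in>carrier G. count_space (carrier G))))
      UNIV"
    and X_1: "\<And>\<omega>. \<omega> \<in> space M \<Longrightarrow> X 1 \<omega> = g 1 \<omega>"
    and X_rec: "\<And>n \<omega>. 2 \<le> n \<Longrightarrow> \<omega> \<in> space M \<Longrightarrow>
      X n \<omega> = (if \<xi> n \<omega> then T n \<omega> (X (u n \<omega>) \<omega>) else g n \<omega>)"

text \<open>\<open>walk G X n \<omega>\<close> is the product \<open>X 1 \<omega> \<cdot> \<dots> \<cdot> X n \<omega>\<close>; the value \<open>X 0\<close> is never used.\<close>

primrec walk ::
  "('a, 'b) monoid_scheme \<Rightarrow> (nat \<Rightarrow> 'w \<Rightarrow> 'a) \<Rightarrow> nat \<Rightarrow> 'w \<Rightarrow> 'a" where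
  "walk G X 0 \<omega> = \<one>\<^bsub>G\<^esub>"
| "walk G X (Suc n) \<omega> = walk G X n \<omega> \<otimes>\<^bsub>G\<^esub> X (Suc n) \<omega>"

definition class_function :: "('a, 'b) monoid_scheme \<Rightarrow> 'a measure \<Rightarrow> bool" where
  "class_function G \<mu> \<longleftrightarrow>
    (\<forall>x\<in>carrier G. \<forall>y\<in>carrier G.
      measure \<mu> {inv\<^bsub>G\<^esub> y \<otimes>\<^bsub>G\<^esub> x \<otimes>\<^bsub>G\<^esub> y} = measure \<mu> {x})"

end

theory Submission
  imports Defs
begin

text \<open>
  Call an innovation \<open>i \<le> n\<close> isolated if no repetition up to time \<open>n\<close> recalls it. Reveal the coins
  and the memories; this determines the set \<open>I\<close> of isolated innovations. Then reveal all the steps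
  \<open>X j\<close> with \<open>j \<le> n\<close> and \<open>j \<notin> I\<close>. A repetition recalls an index outside \<open>I\<close>, so what has been
  revealed about the transformations and the innovations does not involve the steps \<open>X i = g i\<close>
  with \<open>i \<in> I\<close>, which are therefore still independent with law \<open>\<mu>\<close>. The walk at time \<open>n\<close> is now a
  product of these steps and of constants. As \<open>\<mu>\<close> is a class function, a constant can be moved
  past a random step without changing the law, so the walk is distributed as a constant times an
  unreinforced walk of length \<open>card I\<close> (\<open>walk_interspersed_law\<close>). No point has conditional
  probability above \<open>\<epsilon>\<close> once \<open>card I \<ge> m\<close> (\<open>walk_given_steps_le\<close>), hence \<open>P(S n = x)\<close> exceeds \<open>\<epsilon>\<close>
  by at most \<open>P(card I < m)\<close> (\<open>walk_le_few_isolated\<close>).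

  To bound the last probability, follow the number \<open>A n\<close> of isolated innovations in \<open>n\<close>. An
  innovation increases it by one, and a repetition decreases it by one if the recalled index is
  isolated. For the generating function \<open>F n s = E (s ^ A n)\<close>, Bernoulli's inequality turns this
  into
    \<open>F (n + 1) s \<le> (1 - \<alpha>) * s * F n s + \<alpha> * F n (s + (1 - s) / n)\<close>
  (\<open>isolated_gf_Suc_le\<close>), and so by induction
  \<open>F n (1 - \<phi>) \<le> exp (- (3/10) * (1 - \<alpha>) * \<phi> * n)\<close> for \<open>0 \<le> \<phi> \<le> 1/2\<close> (\<open>isolated_gf_le\<close>). Since
  \<open>m \<le> (1 - \<alpha>) * n / 8\<close>, Markov's inequality at \<open>\<phi> = 1/2\<close> gives
  \<open>P(A n < m) \<le> exp (- (1 - \<alpha>) * n / 18)\<close> (\<open>weight_few_isolated_le\<close>).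
\<close>

section \<open>The number of isolated innovations\<close>

text \<open>
  The coins and memories up to time \<open>n\<close>: \<open>c j\<close> is the pair of the coin and the memory at time \<open>j\<close>.
  The memory is recorded even at an innovation, where it has no effect, so that the law of the
  configuration is a product of the laws at the times \<open>2, \<dots>, n\<close>.
\<close>
definition configs :: "nat \<Rightarrow> (nat \<Rightarrow> bool \<times> nat) set" where
  "configs n = (\<Pi>\<^sub>E j\<in>{2..n}. UNIV \<times> {1..<j})"

definition config_weight :: "real \<Rightarrow> nat \<Rightarrow> (nat \<Rightarrow> bool \<times> nat) \<Rightarrow> real" where
  "config_weight \<alpha> n c = (\<Prod>j\<in>{2..n}. (if fst (c j) then \<alpha> else 1 - \<alpha>) * (1 / real (j - 1)))"

text \<open>
  The first step is an innovation without a coin, and \<open>c 1\<close> is an arbitrary value; hence the separate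
  case \<open>i = 1\<close>.
\<close>
definition isolated :: "(nat \<Rightarrow> bool \<times> nat) \<Rightarrow> nat \<Rightarrow> nat set" where
  "isolated c n = {i\<in>{1..n}. (i = 1 \<or> \<not> fst (c i)) \<and> (\<forall>j\<in>{2..n}. fst (c j) \<longrightarrow> snd (c j) \<noteq> i)}"

lemma finite_isolated [simp]: "finite (isolated c n)"
  by (simp add: isolated_def)

lemma isolated_subset: "isolated c n \<subseteq> {1..n}"
  by (auto simp: isolated_def)

lemma finite_configs: "finite (configs n)"
  unfolding configs_def by (intro finite_PiE) auto

lemma config_weight_nonneg: "0 \<le> \<alpha> \<Longrightarrow> \<alpha> \<le> 1 \<Longrightarrow> 0 \<le> config_weight \<alpha> n c"
  unfolding config_weight_def by (intro prod_nonneg) auto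

lemma configs_memory:
  assumes "c \<in> configs n" "j \<in> {2..n}"
  shows "snd (c j) \<in> {1..<j}"
  using PiE_mem[OF assms(1)[unfolded configs_def] assms(2)] by (auto simp: mem_Times_iff)

lemma isolated_innovation:
  assumes "c \<in> configs n" "1 \<le> n"
  shows "isolated (c(Suc n := (False, v))) (Suc n) = insert (Suc n) (isolated c n)"
proof -
  have "snd (c j) \<noteq> Suc n" if "j \<in> {2..n}" for j
    using configs_memory[OF assms(1) that] that by auto
  moreover have "{2..Suc n} = insert (Suc n) {2..n}" using assms(2) by auto
  ultimately show ?thesis
    using assms(2) by (auto simp: isolated_def le_Suc_eq)
qed

lemma isolated_repetition:
  assumes "1 \<le> n"
  shows "isolated (c(Suc n := (True, v))) (Suc n) = isolated c n - {v}"
proof -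
  have "{2..Suc n} = insert (Suc n) {2..n}" using assms by auto
  thus ?thesis using assms by (auto simp: isolated_def le_Suc_eq)
qed

text \<open>
  Averaging over the configurations up to time \<open>n + 1\<close> amounts to averaging first over the coin and
  the memory at time \<open>n + 1\<close>.
\<close>
lemma sum_configs_Suc:
  assumes "1 \<le> n"
  shows "(\<Sum>c\<in>configs (Suc n). config_weight \<alpha> (Suc n) c * f c) =
    (\<Sum>c\<in>configs n. config_weight \<alpha> n c *
      ((1 - \<alpha>) * (\<Sum>v\<in>{1..n}. f (c(Suc n := (False, v)))) / real n
       + \<alpha> * (\<Sum>v\<in>{1..n}. f (c(Suc n := (True, v)))) / real n))"
proof -
  let ?S = "UNIV \<times> {1..n} :: (bool \<times> nat) set"
  have I: "{2..Suc n} = insert (Suc n) {2..n}" using assms by auto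
  have nS: "Suc n \<notin> {2..n}" by simp
  have w: "config_weight \<alpha> (Suc n) (c(Suc n := y)) =
      config_weight \<alpha> n c * ((if fst y then \<alpha> else 1 - \<alpha>) / real n)" for c y
  proof -
    have "(\<Prod>j\<in>{2..n}. (if fst ((c(Suc n := y)) j) then \<alpha> else 1 - \<alpha>) * (1 / real (j - 1)))
        = config_weight \<alpha> n c"
      unfolding config_weight_def by (intro prod.cong) auto
    thus ?thesis
      unfolding config_weight_def[of _ "Suc n"] I by simp
  qed
  have "configs (Suc n) = (\<lambda>(y, c). c(Suc n := y)) ` (?S \<times> configs n)"
    unfolding configs_def I PiE_insert_eq by (simp add: atLeastLessThanSuc_atLeastAtMost)
  moreover have "inj_on (\<lambda>(y, c). c(Suc n := y)) (?S \<times> configs n)"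
    using inj_combinator[OF nS, of "\<lambda>_. ?S"] inj_combinator[OF nS, of "\<lambda>j. UNIV \<times> {1..<j}"]
    unfolding configs_def by (simp add: atLeastLessThanSuc_atLeastAtMost)
  ultimately have "(\<Sum>c\<in>configs (Suc n). config_weight \<alpha> (Suc n) c * f c) =
      (\<Sum>(y, c)\<in>?S \<times> configs n. config_weight \<alpha> n c *
        ((if fst y then \<alpha> else 1 - \<alpha>) / real n) * f (c(Suc n := y)))"
    by (simp add: sum.reindex case_prod_unfold w)
  also have "\<dots> = (\<Sum>c\<in>configs n. \<Sum>y\<in>?S. config_weight \<alpha> n c *
        ((if fst y then \<alpha> else 1 - \<alpha>) / real n) * f (c(Suc n := y)))"
    by (subst sum.swap) (simp add: sum.cartesian_product)
  also have "\<dots> = (\<Sum>c\<in>configs n. config_weight \<alpha> n c *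
      ((1 - \<alpha>) * (\<Sum>v\<in>{1..n}. f (c(Suc n := (False, v)))) / real n
       + \<alpha> * (\<Sum>v\<in>{1..n}. f (c(Suc n := (True, v)))) / real n))"
  proof (rule sum.cong)
    fix c
    have "(\<Sum>y\<in>?S. config_weight \<alpha> n c *
        ((if fst y then \<alpha> else 1 - \<alpha>) / real n) * f (c(Suc n := y)))
      = (\<Sum>b\<in>UNIV. \<Sum>v\<in>{1..n}. config_weight \<alpha> n c *
        ((if b then \<alpha> else 1 - \<alpha>) / real n) * f (c(Suc n := (b, v))))"
      by (simp add: sum.cartesian_product case_prod_unfold)
    thus "(\<Sum>y\<in>?S. config_weight \<alpha> n c *
        ((if fst y then \<alpha> else 1 - \<alpha>) / real n) * f (c(Suc n := y)))
      = config_weight \<alpha> n c *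
      ((1 - \<alpha>) * (\<Sum>v\<in>{1..n}. f (c(Suc n := (False, v)))) / real n
       + \<alpha> * (\<Sum>v\<in>{1..n}. f (c(Suc n := (True, v)))) / real n)"
      by (simp only: UNIV_bool) (simp add: sum_distrib_left sum_divide_distrib distrib_left mult_ac)
  qed simp
  finally show ?thesis .
qed

text \<open>
  Removing a uniformly chosen index has the following effect on \<open>s ^ k\<close>, where \<open>k = card A\<close>. The
  average is \<open>s ^ k * (1 + k * x)\<close> with \<open>x = (1 / s - 1) / n\<close>, and Bernoulli's inequality bounds this
  by the power \<open>(s * (1 + x)) ^ k\<close>. It is again a \<open>k\<close>-th power, which is what allows an induction
  on \<open>n\<close>.
\<close>
lemma sum_power_card_remove_le:
  fixes s :: real
  assumes "A \<subseteq> {1..n}" "0 < s" "s \<le> 1" "1 \<le> n"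
  shows "(\<Sum>v\<in>{1..n}. s ^ card (A - {v})) / real n \<le> (s + (1 - s) / real n) ^ card A"
proof -
  have fA: "finite A" using assms(1) finite_subset by blast
  define k where "k = card A"
  have kn: "k \<le> n" using card_mono[OF _ assms(1)] by (simp add: k_def)
  define x where "x = (1 / s - 1) / real n"
  have x: "0 \<le> x" using assms by (simp add: x_def)
  have "(\<Sum>v\<in>{1..n}. s ^ card (A - {v}))
      = (\<Sum>v\<in>A. s ^ card (A - {v})) + (\<Sum>v\<in>{1..n} - A. s ^ card (A - {v}))"
    by (subst sum.subset_diff[OF assms(1)]) (simp_all only: add.commute finite_atLeastAtMost)
  also have "(\<Sum>v\<in>A. s ^ card (A - {v})) = (\<Sum>v\<in>A. s ^ k / s)"
    using assms(2) fA
  proof (intro sum.cong)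
    fix v assume v: "v \<in> A"
    hence "Suc (card (A - {v})) = k" using card.remove[OF fA v] by (simp add: k_def)
    thus "s ^ card (A - {v}) = s ^ k / s" using assms(2) by auto
  qed simp
  also have "(\<Sum>v\<in>{1..n} - A. s ^ card (A - {v})) = (\<Sum>v\<in>{1..n} - A. s ^ k)"
    by (intro sum.cong arg_cong[where f = "\<lambda>j. s ^ j"]) (auto simp: k_def)
  also have "(\<Sum>v\<in>A. s ^ k / s) + (\<Sum>v\<in>{1..n} - A. s ^ k)
      = real k * s ^ k / s + (real n - real k) * s ^ k"
    using card_Diff_subset[OF fA assms(1)] kn by (simp add: k_def of_nat_diff)
  also have "\<dots> / real n = s ^ k * (1 + real k * x)"
    using assms by (simp add: x_def field_simps)
  also have "\<dots> \<le> s ^ k * (1 + x) ^ k"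
    using Bernoulli_inequality[of x k] x assms by (intro mult_left_mono) auto
  also have "\<dots> = (s * (1 + x)) ^ k"
    by (simp add: power_mult_distrib)
  also have "s * (1 + x) = s + (1 - s) / real n"
    using assms by (simp add: x_def field_simps)
  finally show ?thesis by (simp add: k_def divide_right_mono)
qed

definition isolated_gf :: "real \<Rightarrow> nat \<Rightarrow> real \<Rightarrow> real" where
  "isolated_gf \<alpha> n s = (\<Sum>c\<in>configs n. config_weight \<alpha> n c * s ^ card (isolated c n))"

text \<open>
  An innovation contributes a factor \<open>s\<close>. A repetition removes the recalled index from the isolated
  ones, at the cost of moving the argument \<open>s\<close> by the fraction \<open>1 / n\<close> of its distance to \<open>1\<close>.
\<close>
lemma isolated_gf_Suc_le:
  assumes \<alpha>: "0 \<le> \<alpha>" "\<alpha> \<le> 1" and s: "0 < s" "s \<le> 1" and n: "1 \<le> n"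
  shows "isolated_gf \<alpha> (Suc n) s
    \<le> (1 - \<alpha>) * s * isolated_gf \<alpha> n s + \<alpha> * isolated_gf \<alpha> n (s + (1 - s) / real n)"
proof -
  have "isolated_gf \<alpha> (Suc n) s \<le> (\<Sum>c\<in>configs n. config_weight \<alpha> n c *
      ((1 - \<alpha>) * s * s ^ card (isolated c n)
       + \<alpha> * (s + (1 - s) / real n) ^ card (isolated c n)))"
    unfolding isolated_gf_def sum_configs_Suc[OF n]
  proof (intro sum_mono mult_left_mono add_mono config_weight_nonneg \<alpha>)
    fix c assume c: "c \<in> configs n"
    have "Suc n \<notin> isolated c n" using isolated_subset[of c n] by auto
    thus "(1 - \<alpha>) * (\<Sum>v = 1..n. s ^ card (isolated (c(Suc n := (False, v))) (Suc n))) / real n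
        \<le> (1 - \<alpha>) * s * s ^ card (isolated c n)"
      using n by (simp add: isolated_innovation[OF c n])
    have "(\<Sum>v = 1..n. s ^ card (isolated (c(Suc n := (True, v))) (Suc n))) / real n
        \<le> (s + (1 - s) / real n) ^ card (isolated c n)"
      unfolding isolated_repetition[OF n]
      by (rule sum_power_card_remove_le[OF isolated_subset s n])
    thus "\<alpha> * (\<Sum>v = 1..n. s ^ card (isolated (c(Suc n := (True, v))) (Suc n))) / real n
        \<le> \<alpha> * (s + (1 - s) / real n) ^ card (isolated c n)"
      using \<alpha> mult_left_mono by fastforce
  qed
  also have "\<dots> = (1 - \<alpha>) * s * isolated_gf \<alpha> n s + \<alpha> * isolated_gf \<alpha> n (s + (1 - s) / real n)"
    unfolding isolated_gf_def by (simp add: sum_distrib_left sum.distrib distrib_left mult_ac)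
  finally show ?thesis .
qed

text \<open>
  The induction step of \<open>isolated_gf_le\<close>. To first order in \<open>\<phi>\<close> a rate \<open>r * p\<close> in place of
  \<open>(3/10) * p\<close> requires \<open>r * (2 - p) \<le> 1\<close>, which leaves room for the second order terms as long as
  \<open>\<phi> \<le> 1/2\<close>.
\<close>
lemma exp_mixture_le_one:
  fixes p \<phi> :: real
  assumes p: "0 \<le> p" "p \<le> 1" and \<phi>: "0 \<le> \<phi>" "\<phi> \<le> 1 / 2"
  shows "p * exp (- \<phi> * (1 - 3 / 10 * p)) + (1 - p) * exp (6 / 10 * p * \<phi>) \<le> 1"
proof -
  define q where "q = 1 - 3 / 10 * p"
  have q: "0 \<le> q" "q \<le> 1" using p by (auto simp: q_def)
  define z where "z = \<phi> * q"
  have z: "0 \<le> z" using q \<phi> by (simp add: z_def)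
  have "exp (- z) \<le> 1 - z + z\<^sup>2 / 2"
  proof -
    \<comment> \<open>The product of the two quadratic Taylor polynomials is \<open>1 + z ^ 4 / 4\<close>.\<close>
    have "1 \<le> (1 - z + z\<^sup>2 / 2) * (1 + z + z\<^sup>2 / 2)"
      using zero_le_power[OF z, of 4] by (simp add: eval_nat_numeral algebra_simps)
    also have "\<dots> \<le> (1 - z + z\<^sup>2 / 2) * exp z"
      using exp_lower_Taylor_quadratic[OF z] sum_squares_ge_zero[of "1 - z" 1]
      by (intro mult_left_mono) (auto simp: power2_eq_square algebra_simps)
    finally show ?thesis by (simp add: exp_minus field_simps)
  qed
  hence 1: "p * exp (- z) \<le> p * (1 - z + z\<^sup>2 / 2)" using p by (intro mult_left_mono)
  have t: "0 \<le> 6 / 10 * p * \<phi>" using p \<phi> by simp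
  moreover have "p * \<phi> \<le> 1 * (1 / 2)" using p \<phi> by (intro mult_mono) auto
  ultimately have "exp (6 / 10 * p * \<phi>) \<le> 1 + 6 / 10 * p * \<phi> + (6 / 10 * p * \<phi>)\<^sup>2"
    by (intro exp_bound) auto
  hence 2: "(1 - p) * exp (6 / 10 * p * \<phi>)
      \<le> (1 - p) * (1 + 6 / 10 * p * \<phi> + (6 / 10 * p * \<phi>)\<^sup>2)"
    using p by (intro mult_left_mono) auto
  have "\<phi> * q\<^sup>2 \<le> 1 / 2 * q\<^sup>2" and "\<phi> * p \<le> 1 / 2 * p"
    using mult_right_mono[OF \<phi>(2), of "q\<^sup>2"] mult_right_mono[OF \<phi>(2), of p] p by simp_all
  moreover from this(2) have "(1 - p) * (36 / 100 * (\<phi> * p)) \<le> (1 - p) * (36 / 100 * (1 / 2 * p))"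
    using p by (intro mult_left_mono) auto
  ultimately have "- q + (\<phi> * q\<^sup>2) / 2 + (1 - p) * (6 / 10) + (1 - p) * (36 / 100 * (\<phi> * p))
      \<le> - q + (1 / 2 * q\<^sup>2) / 2 + (1 - p) * (6 / 10) + (1 - p) * (36 / 100 * (1 / 2 * p))"
    by linarith
  also have "\<dots> = - (15 / 100) - 27 / 100 * p - 1575 / 10000 * p\<^sup>2"
    by (simp add: q_def power2_eq_square field_simps)
  also have "\<dots> \<le> 0" using p zero_le_power2[of p] by linarith
  finally have "p * \<phi> * (- q + (\<phi> * q\<^sup>2) / 2 + (1 - p) * (6 / 10)
      + (1 - p) * (36 / 100 * (\<phi> * p))) \<le> 0"
    using p \<phi> by (intro mult_nonneg_nonpos) auto
  hence "p * (1 - z + z\<^sup>2 / 2) + (1 - p) * (1 + 6 / 10 * p * \<phi> + (6 / 10 * p * \<phi>)\<^sup>2) \<le> 1"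
    by (simp add: z_def power2_eq_square algebra_simps)
  thus ?thesis using 1 2 by (simp add: z_def q_def)
qed

text \<open>
  The bound is proved for all \<open>\<phi>\<close> in \<open>[0, 1/2]\<close> together, because the recursion evaluates the
  generating function at time \<open>n\<close> at the smaller parameter \<open>\<phi> * (1 - 1 / n)\<close> as well. This reduction
  costs exactly a factor \<open>exp ((3/10) * (1 - \<alpha>) * \<phi>)\<close>.
\<close>
lemma isolated_gf_le:
  fixes \<alpha> \<phi> :: real
  assumes \<alpha>: "0 \<le> \<alpha>" "\<alpha> \<le> 1" and "0 \<le> \<phi>" "\<phi> \<le> 1 / 2" and n: "1 \<le> n"
  shows "isolated_gf \<alpha> n (1 - \<phi>) \<le> exp (- (3 / 10) * (1 - \<alpha>) * \<phi> * real n)"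
  using n assms(3,4)
proof (induction n arbitrary: \<phi> rule: dec_induct)
  case base
  have "isolated c 1 = {1}" for c by (auto simp: isolated_def)
  hence "isolated_gf \<alpha> 1 (1 - \<phi>) = 1 - \<phi>"
    by (simp add: isolated_gf_def configs_def config_weight_def)
  also have "\<dots> \<le> exp (- \<phi>)" using exp_ge_add_one_self[of "- \<phi>"] by simp
  also have "\<dots> \<le> exp (- (3 / 10) * (1 - \<alpha>) * \<phi> * real 1)"
  proof -
    have "(1 - \<alpha>) * \<phi> \<le> 1 * \<phi>" using \<alpha> base by (intro mult_right_mono) auto
    hence "3 / 10 * ((1 - \<alpha>) * \<phi>) \<le> \<phi>" using base by linarith
    thus ?thesis by (simp add: algebra_simps)
  qed
  finally show ?case .
next
  case (step n)
  define p where "p = 1 - \<alpha>"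
  have p: "0 \<le> p" "p \<le> 1" using \<alpha> by (auto simp: p_def)
  have n: "1 \<le> n" "0 < real n" using step by auto
  define E where "E = exp (- (3 / 10) * p * \<phi> * real (Suc n))"
  define \<phi>' where "\<phi>' = \<phi> * (1 - 1 / real n)"
  have \<phi>': "0 \<le> \<phi>'" "\<phi>' \<le> 1 / 2"
  proof -
    show "0 \<le> \<phi>'" using step n by (simp add: \<phi>'_def)
    have "\<phi> * (1 - 1 / real n) \<le> \<phi> * 1" using step n by (intro mult_left_mono) auto
    thus "\<phi>' \<le> 1 / 2" unfolding \<phi>'_def using step.prems(2) by linarith
  qed
  have "isolated_gf \<alpha> (Suc n) (1 - \<phi>)
      \<le> p * (1 - \<phi>) * isolated_gf \<alpha> n (1 - \<phi>) + \<alpha> * isolated_gf \<alpha> n (1 - \<phi>')"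
    using isolated_gf_Suc_le[OF \<alpha>, of "1 - \<phi>" n] step n
    by (simp add: p_def \<phi>'_def field_simps)
  also have "\<dots> \<le> p * exp (- \<phi>) * exp (- (3 / 10) * p * \<phi> * real n)
      + \<alpha> * exp (- (3 / 10) * p * \<phi>' * real n)"
  proof (intro add_mono mult_mono)
    show "0 \<le> isolated_gf \<alpha> n (1 - \<phi>')"
      unfolding isolated_gf_def using \<phi>'
      by (intro sum_nonneg mult_nonneg_nonneg config_weight_nonneg \<alpha>) auto
    show "isolated_gf \<alpha> n (1 - \<phi>) \<le> exp (- (3 / 10) * p * \<phi> * real n)"
      using step by (simp add: p_def)
    show "isolated_gf \<alpha> n (1 - \<phi>') \<le> exp (- (3 / 10) * p * \<phi>' * real n)"
      using step \<phi>' by (simp add: p_def)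
    show "1 - \<phi> \<le> exp (- \<phi>)" using exp_ge_add_one_self[of "- \<phi>"] by simp
    show "0 \<le> isolated_gf \<alpha> n (1 - \<phi>)"
      unfolding isolated_gf_def using step
      by (intro sum_nonneg mult_nonneg_nonneg config_weight_nonneg \<alpha>) auto
  qed (use p \<alpha> step.prems in auto)
  also have "exp (- (3 / 10) * p * \<phi>' * real n) = E * exp (6 / 10 * p * \<phi>)"
    unfolding E_def exp_add[symmetric] using n by (simp add: \<phi>'_def field_simps)
  also have "p * exp (- \<phi>) * exp (- (3 / 10) * p * \<phi> * real n)
      = E * (p * exp (- \<phi> * (1 - 3 / 10 * p)))"
  proof -
    have "exp (- \<phi>) * exp (- (3 / 10) * p * \<phi> * real n) = E * exp (- \<phi> * (1 - 3 / 10 * p))"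
      unfolding E_def exp_add[symmetric] by (simp add: algebra_simps)
    thus ?thesis by simp
  qed
  also have "E * (p * exp (- \<phi> * (1 - 3 / 10 * p))) + \<alpha> * (E * exp (6 / 10 * p * \<phi>))
      = E * (p * exp (- \<phi> * (1 - 3 / 10 * p)) + (1 - p) * exp (6 / 10 * p * \<phi>))"
    by (simp add: p_def algebra_simps)
  also have "\<dots> \<le> E * 1"
    using exp_mixture_le_one[OF p step.prems] by (intro mult_left_mono) (auto simp: E_def)
  finally show ?case by (simp add: E_def p_def)
qed

text \<open>
  Markov's inequality for \<open>(1/2) ^ card (isolated c n)\<close>. The exponent obtained is
  \<open>(ln 2 / 8 - 3/20) * (1 - \<alpha>) * n\<close>, and \<open>ln 2 / 8 - 3/20 \<le> - 1/18\<close> follows from \<open>ln 2 \<le> 25/36\<close>.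
\<close>
lemma weight_few_isolated_le:
  assumes \<alpha>: "0 \<le> \<alpha>" "\<alpha> < 1" and m: "1 \<le> m" and n: "8 * real m / (1 - \<alpha>) \<le> real n"
  shows "(\<Sum>c\<in>{c\<in>configs n. card (isolated c n) < m}. config_weight \<alpha> n c)
    \<le> exp (- (1 - \<alpha>) * real n / 18)"
proof -
  define p where "p = 1 - \<alpha>"
  have p: "0 < p" using \<alpha> by (simp add: p_def)
  have mn: "8 * real m \<le> p * real n" using n p by (simp add: p_def field_simps)
  have n1: "1 \<le> n" using mn m by (cases n) auto
  have "(\<Sum>c\<in>{c\<in>configs n. card (isolated c n) < m}. config_weight \<alpha> n c)
      \<le> (\<Sum>c\<in>{c\<in>configs n. card (isolated c n) < m}.
          2 ^ m * (config_weight \<alpha> n c * (1 - 1 / 2) ^ card (isolated c n)))"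
  proof (intro sum_mono)
    fix c assume "c \<in> {c\<in>configs n. card (isolated c n) < m}"
    hence "(2::real) ^ card (isolated c n) \<le> 2 ^ m" by (intro power_increasing) auto
    hence "1 \<le> 2 ^ m * (1 - 1 / 2 :: real) ^ card (isolated c n)"
      by (simp add: field_simps power_one_over)
    from mult_left_mono[OF this config_weight_nonneg[of \<alpha> n c]]
    show "config_weight \<alpha> n c \<le> 2 ^ m * (config_weight \<alpha> n c * (1 - 1 / 2) ^ card (isolated c n))"
      using \<alpha> by (simp add: mult_ac)
  qed
  also have "\<dots> \<le> (\<Sum>c\<in>configs n. 2 ^ m * (config_weight \<alpha> n c * (1 - 1 / 2) ^ card (isolated c n)))"
    using \<alpha> by (intro sum_mono2 finite_configs mult_nonneg_nonneg config_weight_nonneg) auto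
  also have "\<dots> = 2 ^ m * isolated_gf \<alpha> n (1 - 1 / 2)"
    by (simp add: isolated_gf_def sum_distrib_left)
  also have "\<dots> \<le> 2 ^ m * exp (- (3 / 10) * (1 - \<alpha>) * (1 / 2) * real n)"
    using \<alpha> n1 by (intro mult_left_mono isolated_gf_le) auto
  also have "(2::real) ^ m = exp (real m * ln 2)" by (simp add: exp_of_nat_mult)
  also have "\<dots> * exp (- (3 / 10) * (1 - \<alpha>) * (1 / 2) * real n)
      = exp (real m * ln 2 - 3 / 20 * (p * real n))"
    by (simp add: exp_add[symmetric] p_def)
  also have "\<dots> \<le> exp (- (1 - \<alpha>) * real n / 18)"
  proof -
    have "real m * ln 2 \<le> p * real n / 8 * (25 / 36)"
      using mn ln2_le_25_over_36 p by (intro mult_mono) auto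
    moreover have "0 \<le> p * real n" using p by simp
    ultimately show ?thesis by (simp add: p_def[symmetric] field_simps)
  qed
  finally show ?thesis .
qed

section \<open>Walks with interspersed constant steps\<close>
lemma walk_cong:
  assumes "\<And>j. 1 \<le> j \<Longrightarrow> j \<le> n \<Longrightarrow> X j \<omega> = Y j \<omega>'"
  shows "walk G X n \<omega> = walk G Y n \<omega>'"
  using assms by (induction n) auto

lemma (in group) walk_measurable:
  assumes "countable (carrier G)"
    and "\<And>j. 1 \<le> j \<Longrightarrow> j \<le> n \<Longrightarrow> X j \<in> N \<rightarrow>\<^sub>M count_space (carrier G)"
  shows "walk G X n \<in> N \<rightarrow>\<^sub>M count_space (carrier G)"
  using assms(2)
proof (induction n)
  case 0
  have "walk G X 0 = (\<lambda>_. \<one>)" by (auto simp: fun_eq_iff)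
  thus ?case by simp
next
  case (Suc n)
  have 1: "walk G X n \<in> N \<rightarrow>\<^sub>M count_space (carrier G)" using Suc by simp
  have 2: "X (Suc n) \<in> N \<rightarrow>\<^sub>M count_space (carrier G)" using Suc by simp
  have "(\<lambda>\<omega>. (\<lambda>h \<omega>. h \<otimes> X (Suc n) \<omega>) (walk G X n \<omega>) \<omega>) \<in> N \<rightarrow>\<^sub>M count_space (carrier G)"
  proof (rule measurable_compose_countable'[OF _ 1 assms(1)])
    fix h assume "h \<in> carrier G"
    hence "(\<lambda>k. h \<otimes> k) \<in> count_space (carrier G) \<rightarrow>\<^sub>M count_space (carrier G)" by simp
    from measurable_compose[OF 2 this]
    show "(\<lambda>\<omega>. h \<otimes> X (Suc n) \<omega>) \<in> N \<rightarrow>\<^sub>M count_space (carrier G)" .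
  qed
  thus ?case by (simp add: fun_eq_iff cong: measurable_cong)
qed

lemma sets_Collect_eq_count_space:
  assumes "\<phi> \<in> N \<rightarrow>\<^sub>M count_space S"
  shows "{f\<in>space N. \<phi> f = x} \<in> sets N"
proof -
  have "{f\<in>space N. \<phi> f \<in> {x} \<inter> S} \<in> sets N"
    by (rule measurable_sets_Collect[OF assms]) auto
  moreover have "{f\<in>space N. \<phi> f \<in> {x} \<inter> S} = {f\<in>space N. \<phi> f = x}"
    using measurable_space[OF assms] by auto
  ultimately show ?thesis by simp
qed

lemma sets_Collect_ball_eq_count_space:
  assumes "finite K" "\<And>j. j \<in> K \<Longrightarrow> \<phi> j \<in> N \<rightarrow>\<^sub>M count_space (S j)"
  shows "{f\<in>space N. \<forall>j\<in>K. \<phi> j f = b j} \<in> sets N"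
  using assms by (intro sets.sets_Collect_finite_All sets_Collect_eq_count_space) auto

lemma (in group) walk_coordinates_measurable:
  assumes "countable (carrier G)" "I \<inter> {1..n} \<subseteq> L"
    and "\<And>j. 1 \<le> j \<Longrightarrow> j \<le> n \<Longrightarrow> j \<notin> I \<Longrightarrow> a j \<in> carrier G"
  shows "walk G (\<lambda>j f. if j \<in> I then f j else a j) n
    \<in> (\<Pi>\<^sub>M j\<in>L. count_space (carrier G)) \<rightarrow>\<^sub>M count_space (carrier G)"
proof (rule walk_measurable[OF assms(1)])
  fix j assume j: "1 \<le> j" "j \<le> n"
  show "(\<lambda>f. if j \<in> I then f j else a j)
      \<in> (\<Pi>\<^sub>M j\<in>L. count_space (carrier G)) \<rightarrow>\<^sub>M count_space (carrier G)"
    using j assms by (cases "j \<in> I") (auto intro!: measurable_component_singleton)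
qed

text \<open>
  The mass at a point of the \<open>k\<close>-fold convolution of \<open>\<mu>\<close> with itself.
\<close>
primrec conv_power :: "('a, 'b) monoid_scheme \<Rightarrow> 'a measure \<Rightarrow> nat \<Rightarrow> 'a \<Rightarrow> ennreal" where
  "conv_power G \<mu> 0 x = indicator {\<one>\<^bsub>G\<^esub>} x"
| "conv_power G \<mu> (Suc k) x = (\<integral>\<^sup>+h. conv_power G \<mu> k (x \<otimes>\<^bsub>G\<^esub> inv\<^bsub>G\<^esub> h) * emeasure \<mu> {h} \<partial>count_space (carrier G))"

text \<open>
  A further random step \<open>h\<close> to the right of a constant \<open>c\<close> may be replaced by \<open>c * h * inv c\<close> to the left
  of it, and for a class function \<open>\<mu>\<close> this conjugate has law \<open>\<mu>\<close> again.
\<close>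
lemma (in group) conv_power_Suc_conjugate:
  assumes \<mu>: "finite_measure \<mu>" "class_function G \<mu>" and x: "x \<in> carrier G" and c: "c \<in> carrier G"
  shows "(\<integral>\<^sup>+h. conv_power G \<mu> k (x \<otimes> inv h \<otimes> inv c) * emeasure \<mu> {h} \<partial>count_space (carrier G))
    = conv_power G \<mu> (Suc k) (x \<otimes> inv c)"
proof -
  interpret \<mu>: finite_measure \<mu> by (fact \<mu>)
  have *: "h = inv c \<otimes> (c \<otimes> h \<otimes> inv c) \<otimes> c" "h = c \<otimes> (inv c \<otimes> h \<otimes> c) \<otimes> inv c"
    if "h \<in> carrier G" for h
    using that c by (simp_all add: m_assoc inv_solve_left inv_solve_right) (simp add: m_assoc[symmetric])
  have bij: "bij_betw (\<lambda>h. c \<otimes> h \<otimes> inv c) (carrier G) (carrier G)"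
    by (rule bij_betw_byWitness[where f' = "\<lambda>h. inv c \<otimes> h \<otimes> c"]) (use * c in auto)
  have "conv_power G \<mu> k (x \<otimes> inv h \<otimes> inv c) * emeasure \<mu> {h}
      = conv_power G \<mu> k (x \<otimes> inv c \<otimes> inv (c \<otimes> h \<otimes> inv c)) * emeasure \<mu> {c \<otimes> h \<otimes> inv c}"
    if h: "h \<in> carrier G" for h
  proof -
    have "emeasure \<mu> {c \<otimes> h \<otimes> inv c} = emeasure \<mu> {h}"
      using \<mu>(2) h inv_closed[OF c] c
      unfolding class_function_def \<mu>.emeasure_eq_measure by (metis inv_inv)
    moreover have "x \<otimes> inv c \<otimes> inv (c \<otimes> h \<otimes> inv c) = x \<otimes> inv h \<otimes> inv c"
    proof -
      have "inv c \<otimes> inv (c \<otimes> h \<otimes> inv c) = inv h \<otimes> inv c"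
        using h c by (simp add: inv_mult_group m_assoc[symmetric])
      thus ?thesis using x h c by (simp add: m_assoc)
    qed
    ultimately show ?thesis by simp
  qed
  hence "(\<integral>\<^sup>+h. conv_power G \<mu> k (x \<otimes> inv h \<otimes> inv c) * emeasure \<mu> {h} \<partial>count_space (carrier G))
    = (\<integral>\<^sup>+h. conv_power G \<mu> k (x \<otimes> inv c \<otimes> inv (c \<otimes> h \<otimes> inv c)) * emeasure \<mu> {c \<otimes> h \<otimes> inv c}
        \<partial>count_space (carrier G))"
    by (intro nn_integral_cong) auto
  also have "\<dots> = conv_power G \<mu> (Suc k) (x \<otimes> inv c)"
    using nn_integral_bij_count_space[OF bij,
        of "\<lambda>h. conv_power G \<mu> k (x \<otimes> inv c \<otimes> inv h) * emeasure \<mu> {h}"] by simp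
  finally show ?thesis .
qed

context prob_space
begin

text \<open>
  The walk in which the steps outside \<open>I\<close> are replaced by constants depends only on the innovations
  in \<open>I\<close>, hence it is independent of any other innovations.
\<close>
lemma prob_fixed_steps_and_walk:
  fixes G (structure)
  assumes G: "group G" "countable (carrier G)"
    and indep: "indep_vars (\<lambda>_. count_space (carrier G)) g {1..}"
    and a: "\<And>j. 1 \<le> j \<Longrightarrow> j \<le> n \<Longrightarrow> j \<notin> I \<Longrightarrow> a j \<in> carrier G"
    and K: "finite K" "K \<subseteq> {1..}" "K \<inter> (I \<inter> {1..n}) = {}"
  shows "prob {\<omega>\<in>space M. (\<forall>j\<in>K. g j \<omega> = b j) \<and>
        walk G (\<lambda>j \<omega>. if j \<in> I then g j \<omega> else a j) n \<omega> = x}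
    = prob {\<omega>\<in>space M. \<forall>j\<in>K. g j \<omega> = b j} *
      prob {\<omega>\<in>space M. walk G (\<lambda>j \<omega>. if j \<in> I then g j \<omega> else a j) n \<omega> = x}"
proof -
  interpret G: group G by (fact G)
  let ?C = "\<lambda>_. count_space (carrier G)" and ?L = "I \<inter> {1..n}"
  let ?Z = "\<lambda>j \<omega>. if j \<in> I then g j \<omega> else a j"
  let ?W = "walk G (\<lambda>j f. if j \<in> I then f j else a j) n"
  have g: "g j \<in> M \<rightarrow>\<^sub>M count_space (carrier G)" if "1 \<le> j" for j
    using indep that by (auto simp: indep_vars_def)
  have ind: "indep_var (PiM K ?C) (\<lambda>\<omega>. \<lambda>j\<in>K. g j \<omega>) (PiM ?L ?C) (\<lambda>\<omega>. \<lambda>j\<in>?L. g j \<omega>)"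
    using K by (intro indep_var_restrict[OF indep]) auto
  have HK: "{f\<in>space (PiM K ?C). \<forall>j\<in>K. f j = b j} \<in> sets (PiM K ?C)"
    by (intro sets_Collect_ball_eq_count_space[where S = "\<lambda>_. carrier G"] K measurable_component_singleton)
  have QL: "{f\<in>space (PiM ?L ?C). ?W f = x} \<in> sets (PiM ?L ?C)"
    by (intro sets_Collect_eq_count_space[where S = "carrier G"] G.walk_coordinates_measurable G a order_refl)
  have sp: "(\<lambda>j\<in>A. g j \<omega>) \<in> space (PiM A ?C)" if "A \<subseteq> {1..}" "\<omega> \<in> space M" for A \<omega>
    using that measurable_space[OF g] by (auto simp: space_PiM)
  have w: "?W (\<lambda>j\<in>?L. g j \<omega>) = walk G ?Z n \<omega>" for \<omega>
    by (intro walk_cong) auto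
  have e1: "(\<lambda>\<omega>. \<lambda>j\<in>K. g j \<omega>) -` {f\<in>space (PiM K ?C). \<forall>j\<in>K. f j = b j} \<inter> space M
      = {\<omega>\<in>space M. \<forall>j\<in>K. g j \<omega> = b j}"
    using sp[OF K(2)] by auto
  have L: "?L \<subseteq> {1..}" by auto
  have e2: "(\<lambda>\<omega>. \<lambda>j\<in>?L. g j \<omega>) -` {f\<in>space (PiM ?L ?C). ?W f = x} \<inter> space M
      = {\<omega>\<in>space M. walk G ?Z n \<omega> = x}"
  proof (intro Set.set_eqI iffI)
    fix \<omega> assume "\<omega> \<in> {\<omega>\<in>space M. walk G ?Z n \<omega> = x}"
    thus "\<omega> \<in> (\<lambda>\<omega>. \<lambda>j\<in>?L. g j \<omega>) -` {f\<in>space (PiM ?L ?C). ?W f = x} \<inter> space M"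
      using sp[OF L, of \<omega>] w[of \<omega>] by simp
  qed (use w in \<open>auto simp only: vimage_eq Int_iff mem_Collect_eq\<close>)
  have e3: "(\<lambda>\<omega>. (\<lambda>j\<in>K. g j \<omega>, \<lambda>j\<in>?L. g j \<omega>)) -`
      ({f\<in>space (PiM K ?C). \<forall>j\<in>K. f j = b j} \<times> {f\<in>space (PiM ?L ?C). ?W f = x}) \<inter> space M
    = {\<omega>\<in>space M. (\<forall>j\<in>K. g j \<omega> = b j) \<and> walk G ?Z n \<omega> = x}"
    using e1 e2 by blast
  show ?thesis
    using indep_varD[OF ind HK QL] unfolding e1 e2 e3 .
qed

text \<open>
  Pushing all constants to the right end of the product, by \<open>conv_power_Suc_conjugate\<close>, leaves a product
  of independent steps with law \<open>\<mu>\<close>, one for each index in \<open>I\<close>, times a constant \<open>c\<close>.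
\<close>
lemma walk_interspersed_law:
  fixes G (structure)
  assumes G: "group G" "countable (carrier G)"
    and \<mu>: "class_function G \<mu>"
    and indep: "indep_vars (\<lambda>_. count_space (carrier G)) g {1..}"
    and distr: "\<And>j. 1 \<le> j \<Longrightarrow> distr M (count_space (carrier G)) (g j) = \<mu>"
    and a: "\<And>j. 1 \<le> j \<Longrightarrow> j \<le> n \<Longrightarrow> j \<notin> I \<Longrightarrow> a j \<in> carrier G"
  shows "\<exists>c\<in>carrier G. \<forall>x\<in>carrier G.
    emeasure M {\<omega>\<in>space M. walk G (\<lambda>j \<omega>. if j \<in> I then g j \<omega> else a j) n \<omega> = x}
      = conv_power G \<mu> (card (I \<inter> {1..n})) (x \<otimes> inv c)"
  using a
proof (induction n)
  case 0
  interpret G: group G by (fact G)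
  have "{\<omega>\<in>space M. \<one> = x} = (if x = \<one> then space M else {})" for x
    by auto
  thus ?case by (intro bexI[of _ \<one>]) (auto simp: emeasure_space_1)
next
  case (Suc n)
  interpret G: group G by (fact G)
  let ?Z = "\<lambda>j \<omega>. if j \<in> I then g j \<omega> else a j"
  have g: "g j \<in> M \<rightarrow>\<^sub>M count_space (carrier G)" if "1 \<le> j" for j
    using indep that by (auto simp: indep_vars_def)
  have fin: "finite_measure \<mu>"
    unfolding distr[OF le_refl, symmetric] by (intro finite_measure_distr g) simp
  have Zm: "?Z j \<in> M \<rightarrow>\<^sub>M count_space (carrier G)" if "1 \<le> j" "j \<le> Suc n" for j
    using g that Suc.prems by (cases "j \<in> I") auto
  have wm: "walk G ?Z n \<in> M \<rightarrow>\<^sub>M count_space (carrier G)"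
    by (rule G.walk_measurable[OF G(2)]) (use Zm in auto)
  have wc: "walk G ?Z n \<omega> \<in> carrier G" if "\<omega> \<in> space M" for \<omega>
    using measurable_space[OF wm that] by simp
  obtain c where c: "c \<in> carrier G" and IH: "\<And>x. x \<in> carrier G \<Longrightarrow>
      emeasure M {\<omega>\<in>space M. walk G ?Z n \<omega> = x}
      = conv_power G \<mu> (card (I \<inter> {1..n})) (x \<otimes> inv c)"
    using Suc by fastforce
  show ?case
  proof (cases "Suc n \<in> I")
    case False
    hence aS: "a (Suc n) \<in> carrier G" using Suc.prems by simp
    have "I \<inter> {1..Suc n} = I \<inter> {1..n}" using False le_Suc_eq by auto
    moreover have "{\<omega>\<in>space M. walk G ?Z (Suc n) \<omega> = x}
        = {\<omega>\<in>space M. walk G ?Z n \<omega> = x \<otimes> inv (a (Suc n))}" if "x \<in> carrier G" for x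
      using False aS wc that G.inv_solve_right[OF that aS] G.inv_solve_right'
      by (auto simp: G.inv_solve_right)
    moreover have "x \<otimes> inv (a (Suc n)) \<otimes> inv c = x \<otimes> inv (c \<otimes> a (Suc n))"
      if "x \<in> carrier G" for x
      using that aS c by (simp add: G.inv_mult_group G.m_assoc)
    ultimately show ?thesis
      using IH aS c by (intro bexI[of _ "c \<otimes> a (Suc n)"]) auto
  next
    case True
    have card: "card (I \<inter> {1..Suc n}) = Suc (card (I \<inter> {1..n}))"
    proof -
      have "I \<inter> {1..Suc n} = insert (Suc n) (I \<inter> {1..n})" using True by auto
      thus ?thesis by simp
    qed
    have "emeasure M {\<omega>\<in>space M. walk G ?Z (Suc n) \<omega> = x}
        = conv_power G \<mu> (card (I \<inter> {1..Suc n})) (x \<otimes> inv c)" if x: "x \<in> carrier G" for x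
    proof -
      let ?D = "\<lambda>h. {\<omega>\<in>space M. g (Suc n) \<omega> = h \<and> walk G ?Z n \<omega> = x \<otimes> inv h}"
      have gS: "g (Suc n) \<omega> \<in> carrier G" if "\<omega> \<in> space M" for \<omega>
        using measurable_space[OF g that] by simp
      have D_sets: "?D h \<in> sets M" if "h \<in> carrier G" for h
      proof -
        have "g (Suc n) -` {h} \<inter> space M \<in> sets M" "walk G ?Z n -` {x \<otimes> inv h} \<inter> space M \<in> sets M"
          using that x by (auto intro!: measurable_sets[OF g] measurable_sets[OF wm])
        from sets.Int[OF this] show ?thesis by (rule back_subst) auto
      qed
      have D: "emeasure M (?D h) = conv_power G \<mu> (card (I \<inter> {1..n})) (x \<otimes> inv h \<otimes> inv c) * emeasure \<mu> {h}"
        if h: "h \<in> carrier G" for h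
      proof -
        have "prob (?D h) = prob {\<omega>\<in>space M. g (Suc n) \<omega> = h} *
            prob {\<omega>\<in>space M. walk G ?Z n \<omega> = x \<otimes> inv h}"
          using prob_fixed_steps_and_walk[OF G indep, of n I a "{Suc n}" "\<lambda>_. h" "x \<otimes> inv h"] Suc.prems
          by simp
        hence "emeasure M (?D h) = emeasure M {\<omega>\<in>space M. g (Suc n) \<omega> = h} *
            emeasure M {\<omega>\<in>space M. walk G ?Z n \<omega> = x \<otimes> inv h}"
          by (simp add: emeasure_eq_measure ennreal_mult)
        also have "emeasure M {\<omega>\<in>space M. g (Suc n) \<omega> = h} = emeasure \<mu> {h}"
        proof -
          have "emeasure (distr M (count_space (carrier G)) (g (Suc n))) {h}
              = emeasure M (g (Suc n) -` {h} \<inter> space M)"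
            using h by (intro emeasure_distr g) auto
          also have "g (Suc n) -` {h} \<inter> space M = {\<omega>\<in>space M. g (Suc n) \<omega> = h}" by auto
          finally show ?thesis using distr[of "Suc n"] by simp
        qed
        finally show ?thesis using IH[of "x \<otimes> inv h"] h x by (simp add: mult.commute)
      qed
      have "{\<omega>\<in>space M. walk G ?Z (Suc n) \<omega> = x} = (\<Union>h\<in>carrier G. ?D h)"
        using True gS wc x by (auto simp: G.inv_solve_right)
      also have "emeasure M \<dots> = (\<integral>\<^sup>+h. emeasure M (?D h) \<partial>count_space (carrier G))"
        by (intro emeasure_UN_countable D_sets G) (auto simp: disjoint_family_on_def)
      also have "\<dots> = (\<integral>\<^sup>+h. conv_power G \<mu> (card (I \<inter> {1..n})) (x \<otimes> inv h \<otimes> inv c) * emeasure \<mu> {h}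
          \<partial>count_space (carrier G))"
        by (intro nn_integral_cong) (use D in auto)
      also have "\<dots> = conv_power G \<mu> (Suc (card (I \<inter> {1..n}))) (x \<otimes> inv c)"
        by (rule G.conv_power_Suc_conjugate[OF fin \<mu> x c])
      finally show ?thesis by (simp only: card)
    qed
    thus ?thesis using c by blast
  qed
qed

lemma measure_le_by_partition:
  assumes K: "countable K" and f: "\<And>\<omega>. \<omega> \<in> space M \<Longrightarrow> f \<omega> \<in> K"
    and sets: "\<And>k. k \<in> K \<Longrightarrow> {\<omega>\<in>space M. P \<omega> \<and> f \<omega> = k} \<in> sets M"
      "\<And>k. k \<in> K \<Longrightarrow> {\<omega>\<in>space M. Q \<omega> \<and> f \<omega> = k} \<in> sets M"
    and le: "\<And>k. k \<in> K \<Longrightarrow> prob {\<omega>\<in>space M. P \<omega> \<and> f \<omega> = k}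
      \<le> \<epsilon> * prob {\<omega>\<in>space M. Q \<omega> \<and> f \<omega> = k}"
    and \<epsilon>: "0 \<le> \<epsilon>"
  shows "prob {\<omega>\<in>space M. P \<omega>} \<le> \<epsilon> * prob {\<omega>\<in>space M. Q \<omega>}"
proof -
  have split: "emeasure M {\<omega>\<in>space M. R \<omega>}
      = (\<integral>\<^sup>+k. emeasure M {\<omega>\<in>space M. R \<omega> \<and> f \<omega> = k} \<partial>count_space K)"
    if "\<And>k. k \<in> K \<Longrightarrow> {\<omega>\<in>space M. R \<omega> \<and> f \<omega> = k} \<in> sets M" for R
  proof -
    have "{\<omega>\<in>space M. R \<omega>} = (\<Union>k\<in>K. {\<omega>\<in>space M. R \<omega> \<and> f \<omega> = k})" using f by auto
    also have "emeasure M \<dots> = (\<integral>\<^sup>+k. emeasure M {\<omega>\<in>space M. R \<omega> \<and> f \<omega> = k} \<partial>count_space K)"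
      by (intro emeasure_UN_countable that K) (auto simp: disjoint_family_on_def)
    finally show ?thesis .
  qed
  have "emeasure M {\<omega>\<in>space M. P \<omega>}
      \<le> (\<integral>\<^sup>+k. ennreal \<epsilon> * emeasure M {\<omega>\<in>space M. Q \<omega> \<and> f \<omega> = k} \<partial>count_space K)"
    unfolding split[of P, OF sets(1), simplified] using le \<epsilon>
    by (intro nn_integral_mono) (auto simp: emeasure_eq_measure ennreal_mult[symmetric])
  also have "\<dots> = ennreal \<epsilon> * emeasure M {\<omega>\<in>space M. Q \<omega>}"
    unfolding split[of Q, OF sets(2), simplified] by (rule nn_integral_cmult) simp
  finally show ?thesis
    using \<epsilon> by (simp add: emeasure_eq_measure ennreal_mult[symmetric])
qed

end

section \<open>Independence of the sources\<close>
lemma restrict_eq_iff_of_PiE: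
  assumes "a \<in> J \<rightarrow>\<^sub>E S"
  shows "restrict f J = a \<longleftrightarrow> (\<forall>j\<in>J. f j = a j)"
proof
  assume "\<forall>j\<in>J. f j = a j"
  thus "restrict f J = a" using PiE_arb[OF assms] by (intro ext) (auto simp: restrict_def)
qed auto

context srrw
begin

definition config :: "nat \<Rightarrow> 'w \<Rightarrow> nat \<Rightarrow> bool \<times> nat" where
  "config n \<omega> = (\<lambda>j\<in>{2..n}. (\<xi> j \<omega>, u j \<omega>))"

lemma g_measurable: "1 \<le> n \<Longrightarrow> g n \<in> M \<rightarrow>\<^sub>M count_space (carrier G)"
  using indep_g by (auto simp: indep_vars_def)

lemma coin_measurable: "2 \<le> n \<Longrightarrow> \<xi> n \<in> M \<rightarrow>\<^sub>M count_space UNIV"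
  using indep_xi unfolding indep_vars_def by blast

lemma memory_measurable: "2 \<le> n \<Longrightarrow> u n \<in> M \<rightarrow>\<^sub>M count_space {1..<n}"
  using indep_u by (auto simp: indep_vars_def)

lemma memory_mem: "2 \<le> n \<Longrightarrow> \<omega> \<in> space M \<Longrightarrow> u n \<omega> \<in> {1..<n}"
  using measurable_space[OF memory_measurable] by simp

lemma transformation_measurable:
  assumes n: "2 \<le> n" and Y: "Y \<in> M \<rightarrow>\<^sub>M count_space (carrier G)"
  shows "(\<lambda>\<omega>. T n \<omega> (Y \<omega>)) \<in> M \<rightarrow>\<^sub>M count_space (carrier G)"
proof -
  have "(\<lambda>\<omega>. (\<omega>, Y \<omega>)) \<in> M \<rightarrow>\<^sub>M M \<Otimes>\<^sub>M count_space (carrier G)"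
    using Y by (intro measurable_Pair) auto
  from measurable_compose[OF this measurable_T[OF n]] show ?thesis by simp
qed

lemma step_measurable:
  assumes "1 \<le> n"
  shows "X n \<in> M \<rightarrow>\<^sub>M count_space (carrier G)"
  using assms
proof (induction n rule: less_induct)
  case (less n)
  show ?case
  proof (cases "n = 1")
    case True
    thus ?thesis using g_measurable[of 1] X_1 by (simp cong: measurable_cong)
  next
    case False
    hence n: "2 \<le> n" using less.prems by simp
    have "(\<lambda>\<omega>. X (u n \<omega>) \<omega>) \<in> M \<rightarrow>\<^sub>M count_space (carrier G)"
      by (rule measurable_compose_countable'[OF _ memory_measurable[OF n]]) (use less.IH in auto)
    hence "(\<lambda>\<omega>. if \<xi> n \<omega> then T n \<omega> (X (u n \<omega>) \<omega>) else g n \<omega>) \<in> M \<rightarrow>\<^sub>M count_space (carrier G)"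
      using sets_Collect_eq_count_space[OF coin_measurable[OF n], of True] less.prems
      by (intro measurable_If transformation_measurable n g_measurable) auto
    thus ?thesis using X_rec[OF n] by (simp cong: measurable_cong)
  qed
qed

lemma config_in_configs: "\<omega> \<in> space M \<Longrightarrow> config n \<omega> \<in> configs n"
  using memory_mem unfolding config_def configs_def by (intro restrict_PiE_iff[THEN iffD2]) auto

lemma config_eq_iff:
  assumes "c \<in> configs n"
  shows "config n \<omega> = c \<longleftrightarrow>
    (\<forall>j\<in>{2..n}. \<xi> j \<omega> = fst (c j)) \<and> (\<forall>j\<in>{2..n}. u j \<omega> = snd (c j))"
proof
  assume "(\<forall>j\<in>{2..n}. \<xi> j \<omega> = fst (c j)) \<and> (\<forall>j\<in>{2..n}. u j \<omega> = snd (c j))"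
  moreover have "c j = undefined" if "j \<notin> {2..n}" for j
    using assms that unfolding configs_def by (rule PiE_arb)
  ultimately show "config n \<omega> = c"
    by (intro ext) (auto simp: config_def restrict_def)
qed (auto simp: config_def)

text \<open>
  The independence of the four sources in the form used below: a configuration fixes the coins and
  the memories, the transformations enter only through the values at given points, and the event
  for the innovations is arbitrary.
\<close>
lemma prob_config_transformations_innovations:
  assumes c: "c \<in> configs n" and R: "finite R" "R \<subseteq> {2..}" "\<And>j. j \<in> R \<Longrightarrow> h j \<in> carrier G"
    and A: "A \<in> sets (\<Pi>\<^sub>M n\<in>{1..}. count_space (carrier G))"
  shows "prob {\<omega>\<in>space M. config n \<omega> = c \<and> (\<forall>j\<in>R. T j \<omega> (h j) = k j)
        \<and> (\<lambda>n\<in>{1..}. g n \<omega>) \<in> A}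
    = prob {\<omega>\<in>space M. \<forall>j\<in>{2..n}. \<xi> j \<omega> = fst (c j)}
      * prob {\<omega>\<in>space M. \<forall>j\<in>{2..n}. u j \<omega> = snd (c j)}
      * prob {\<omega>\<in>space M. \<forall>j\<in>R. T j \<omega> (h j) = k j}
      * prob {\<omega>\<in>space M. (\<lambda>n\<in>{1..}. g n \<omega>) \<in> A}"
proof -
  \<comment> \<open>One event for each source; the independence assumption applies to their intersection.\<close>
  define E where "E s = (case s of
      Innovations \<Rightarrow> {\<omega>\<in>space M. (\<lambda>n\<in>{1..}. g n \<omega>) \<in> A}
    | Coins \<Rightarrow> {\<omega>\<in>space M. \<forall>j\<in>{2..n}. \<xi> j \<omega> = fst (c j)}
    | Memories \<Rightarrow> {\<omega>\<in>space M. \<forall>j\<in>{2..n}. u j \<omega> = snd (c j)}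
    | Transformations \<Rightarrow> {\<omega>\<in>space M. \<forall>j\<in>R. T j \<omega> (h j) = k j})" for s
  have U: "(UNIV :: source set) = {Innovations, Coins, Memories, Transformations}"
    by (auto intro: source.exhaust)
  let ?PX = "\<Pi>\<^sub>M n\<in>{2..}. count_space (UNIV :: bool set)"
  let ?PU = "\<Pi>\<^sub>M n\<in>{2..}. count_space {1..<n}"
  let ?PT = "\<Pi>\<^sub>M n\<in>{2..}. \<Pi>\<^sub>M x\<in>carrier G. count_space (carrier G)"
  have Tc: "T j \<omega> x \<in> carrier G" if "2 \<le> j" "\<omega> \<in> space M" "x \<in> carrier G" for j \<omega> x
    using measurable_space[OF transformation_measurable[OF that(1), of "\<lambda>_. x"] that(2)] that(3)
    by simp
  have innov: "E Innovations \<in> sets (vimage_algebra (space M)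
      (\<lambda>\<omega>. \<lambda>n\<in>{1..}. g n \<omega>) (\<Pi>\<^sub>M n\<in>{1..}. count_space (carrier G)))"
    using in_vimage_algebra[OF A, of "\<lambda>\<omega>. \<lambda>n\<in>{1..}. g n \<omega>" "space M"]
    by (simp add: E_def vimage_def Int_def conj_commute)
  have coins: "E Coins \<in> sets (vimage_algebra (space M) (\<lambda>\<omega>. \<lambda>n\<in>{2..}. \<xi> n \<omega>) ?PX)"
  proof -
    have "{f\<in>space ?PX. \<forall>j\<in>{2..n}. f j = fst (c j)} \<in> sets ?PX"
      by (intro sets_Collect_ball_eq_count_space[where S = "\<lambda>_. UNIV"] measurable_component_singleton) auto
    from in_vimage_algebra[OF this, of "\<lambda>\<omega>. \<lambda>n\<in>{2..}. \<xi> n \<omega>" "space M"]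
    show ?thesis by (rule back_subst[of "\<lambda>A. A \<in> _"]) (auto simp: E_def space_PiM)
  qed
  have memories: "E Memories \<in> sets (vimage_algebra (space M) (\<lambda>\<omega>. \<lambda>n\<in>{2..}. u n \<omega>) ?PU)"
  proof -
    have *: "{f\<in>space ?PU. \<forall>j\<in>{2..n}. f j = snd (c j)} \<in> sets ?PU"
      by (intro sets_Collect_ball_eq_count_space[where S = "\<lambda>j. {1..<j}"] measurable_component_singleton) auto
    have eq: "(\<lambda>\<omega>. \<lambda>n\<in>{2..}. u n \<omega>) -` {f\<in>space ?PU. \<forall>j\<in>{2..n}. f j = snd (c j)} \<inter> space M
        = E Memories"
      using memory_mem by (auto simp: E_def space_PiM)
    show ?thesis
      using in_vimage_algebra[OF *, of "\<lambda>\<omega>. \<lambda>n\<in>{2..}. u n \<omega>" "space M"] unfolding eq .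
  qed
  have transf: "E Transformations \<in> sets (vimage_algebra (space M)
      (\<lambda>\<omega>. \<lambda>n\<in>{2..}. \<lambda>x\<in>carrier G. T n \<omega> x) ?PT)"
  proof -
    have *: "{f\<in>space ?PT. \<forall>j\<in>R. f j (h j) = k j} \<in> sets ?PT"
    proof (rule sets_Collect_ball_eq_count_space[where S = "\<lambda>_. carrier G", OF R(1)])
      fix j assume j: "j \<in> R"
      have "(\<lambda>f. f j) \<in> ?PT \<rightarrow>\<^sub>M (\<Pi>\<^sub>M x\<in>carrier G. count_space (carrier G))"
        using j R by (intro measurable_component_singleton) auto
      from measurable_compose[OF this measurable_component_singleton[OF R(3)[OF j]]]
      show "(\<lambda>f. f j (h j)) \<in> ?PT \<rightarrow>\<^sub>M count_space (carrier G)" .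
    qed
    have eq: "(\<lambda>\<omega>. \<lambda>n\<in>{2..}. \<lambda>x\<in>carrier G. T n \<omega> x) -`
        {f\<in>space ?PT. \<forall>j\<in>R. f j (h j) = k j} \<inter> space M = E Transformations"
      using Tc R(2,3) by (auto simp: E_def space_PiM subset_iff)
    show ?thesis
      using in_vimage_algebra[OF *, of "\<lambda>\<omega>. \<lambda>n\<in>{2..}. \<lambda>x\<in>carrier G. T n \<omega> x" "space M"]
      unfolding eq .
  qed
  have "prob (\<Inter>s\<in>UNIV. E s) = (\<Prod>s\<in>UNIV. prob (E s))"
    by (rule indep_setsD[OF indep_sources])
       (use innov coins memories transf in \<open>auto simp: U split: source.split\<close>)
  also have "(\<Inter>s\<in>UNIV. E s) = {\<omega>\<in>space M. config n \<omega> = c \<and> (\<forall>j\<in>R. T j \<omega> (h j) = k j)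
        \<and> (\<lambda>n\<in>{1..}. g n \<omega>) \<in> A}"
    unfolding U config_eq_iff[OF c] by (auto simp: E_def)
  also have "(\<Prod>s\<in>UNIV. prob (E s)) = prob (E Coins) * prob (E Memories)
      * prob (E Transformations) * prob (E Innovations)"
    unfolding U by (simp add: mult_ac)
  finally show ?thesis by (simp add: E_def)
qed

lemma prob_coin: "2 \<le> j \<Longrightarrow> prob (\<xi> j -` {b} \<inter> space M) = (if b then \<alpha> else 1 - \<alpha>)"
  using measure_distr[OF coin_measurable, of j "{b}"] alpha
  by (cases b) (simp_all add: distr_xi measure_pmf_single)

lemma prob_memory:
  assumes "2 \<le> j" "v \<in> {1..<j}"
  shows "prob (u j -` {v} \<inter> space M) = 1 / real (j - 1)"
  using measure_distr[OF memory_measurable, of j "{v}"] assms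
  by (simp add: distr_u[OF assms(1), simplified] measure_uniform_count_measure)

lemma prob_config:
  assumes c: "c \<in> configs n" and n: "2 \<le> n"
  shows "prob {\<omega>\<in>space M. config n \<omega> = c} = config_weight \<alpha> n c"
proof -
  have ne: "{2..n} \<noteq> {}" using n by simp
  have "prob {\<omega>\<in>space M. \<forall>j\<in>{2..n}. \<xi> j \<omega> = fst (c j)}
      = prob (\<Inter>j\<in>{2..n}. \<xi> j -` {fst (c j)} \<inter> space M)"
    using n by (intro arg_cong[where f = prob]) auto
  also have "\<dots> = (\<Prod>j\<in>{2..n}. prob (\<xi> j -` {fst (c j)} \<inter> space M))"
    by (rule indep_varsD_finite[OF indep_vars_subset[OF indep_xi]]) (use n in auto)
  also have "\<dots> = (\<Prod>j\<in>{2..n}. if fst (c j) then \<alpha> else 1 - \<alpha>)"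
    by (intro prod.cong prob_coin) auto
  finally have coins: "prob {\<omega>\<in>space M. \<forall>j\<in>{2..n}. \<xi> j \<omega> = fst (c j)} = \<dots>" .
  have "prob {\<omega>\<in>space M. \<forall>j\<in>{2..n}. u j \<omega> = snd (c j)}
      = prob (\<Inter>j\<in>{2..n}. u j -` {snd (c j)} \<inter> space M)"
    using n by (intro arg_cong[where f = prob]) auto
  also have "\<dots> = (\<Prod>j\<in>{2..n}. prob (u j -` {snd (c j)} \<inter> space M))"
    by (rule indep_varsD_finite[OF indep_vars_subset[OF indep_u]])
       (use n configs_memory[OF c] in auto)
  also have "\<dots> = (\<Prod>j\<in>{2..n}. 1 / real (j - 1))"
    by (intro prod.cong prob_memory) (use configs_memory[OF c] in auto)
  finally have memories: "prob {\<omega>\<in>space M. \<forall>j\<in>{2..n}. u j \<omega> = snd (c j)} = \<dots>" .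
  have "(\<lambda>n\<in>{1..}. g n \<omega>) \<in> space (\<Pi>\<^sub>M n\<in>{1..}. count_space (carrier G))"
    if "\<omega> \<in> space M" for \<omega>
    using measurable_space[OF g_measurable that] by (auto simp: space_PiM)
  hence "{\<omega>\<in>space M. (\<lambda>n\<in>{1..}. g n \<omega>) \<in> space (\<Pi>\<^sub>M n\<in>{1..}. count_space (carrier G))} = space M"
    and "{\<omega>\<in>space M. config n \<omega> = c \<and>
      (\<lambda>n\<in>{1..}. g n \<omega>) \<in> space (\<Pi>\<^sub>M n\<in>{1..}. count_space (carrier G))}
      = {\<omega>\<in>space M. config n \<omega> = c}"
    by blast+
  thus ?thesis
    using prob_config_transformations_innovations[OF c, of "{}" _
        "space (\<Pi>\<^sub>M n\<in>{1..}. count_space (carrier G))"]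
    by (simp add: coins memories config_weight_def prod.distrib[symmetric] prob_space)
qed

section \<open>The bound for the reinforced walk\<close>

text \<open>
  Given the configuration \<open>c\<close> and the values \<open>a\<close> of the steps that are not isolated innovations, the
  walk is a product of constants and independent steps, as in
  \<open>walk_interspersed_law\<close>. The point is that the conditioning can be rewritten in
  terms of independent events: once \<open>X (snd (c j))\<close> is known to be \<open>a (snd (c j))\<close>, a repetition at
  time \<open>j\<close> has the value \<open>a j\<close> if and only if \<open>T j\<close> maps \<open>a (snd (c j))\<close> to \<open>a j\<close>, which no longer
  refers to the random steps.
\<close>
lemma walk_given_steps_le:
  fixes \<epsilon> :: real
  assumes countable: "countable (carrier G)" and conj_inv: "class_function G \<mu>"
    and bound: "\<And>y. y \<in> carrier G \<Longrightarrow> conv_power G \<mu> (card (isolated c n)) y \<le> ennreal \<epsilon>" "0 \<le> \<epsilon>"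
    and c: "c \<in> configs n" and a: "a \<in> ({1..n} - isolated c n) \<rightarrow>\<^sub>E carrier G"
    and x: "x \<in> carrier G"
  shows "prob {\<omega>\<in>space M. walk G X n \<omega> = x \<and> config n \<omega> = c
        \<and> (\<lambda>j\<in>{1..n} - isolated c n. X j \<omega>) = a}
    \<le> \<epsilon> * prob {\<omega>\<in>space M. config n \<omega> = c \<and> (\<lambda>j\<in>{1..n} - isolated c n. X j \<omega>) = a}"
proof -
  define I where "I = isolated c n"
  define J where "J = {1..n} - I"
  define K where "K = {j\<in>J. j = 1 \<or> \<not> fst (c j)}"
  define R where "R = {j\<in>{2..n}. fst (c j)}"
  have In: "I \<subseteq> {1..n}" unfolding I_def by (rule isolated_subset)
  \<comment> \<open>Outside \<open>I\<close> there are the recalled innovations \<open>K\<close> and the repetitions \<open>R\<close>.\<close>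
  have KR: "J = K \<union> R"
    by (auto simp: J_def K_def R_def I_def isolated_def)
  \<comment> \<open>A recalled index is not isolated, so its step is among the given ones.\<close>
  have RJ: "snd (c j) \<in> J \<and> snd (c j) < j" if "j \<in> R" for j
    using that configs_memory[OF c, of j] by (auto simp: J_def R_def I_def isolated_def)
  have aJ: "a j \<in> carrier G" if "j \<in> J" for j
    using a that unfolding J_def I_def by (rule PiE_mem)
  have aI: "a j \<in> carrier G" if "1 \<le> j" "j \<le> n" "j \<notin> I" for j
    using aJ that by (simp add: J_def)
  let ?Z = "\<lambda>j \<omega>. if j \<in> I then g j \<omega> else a j"
  let ?W = "walk G (\<lambda>j f. if j \<in> I then f j else a j) n"
  let ?P = "\<Pi>\<^sub>M j\<in>{1..}. count_space (carrier G)"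
  let ?\<tau> = "\<lambda>\<omega>. \<forall>j\<in>R. T j \<omega> (a (snd (c j))) = a j"

  \<comment> \<open>On the event that the configuration is \<open>c\<close>, the condition on the steps splits into one on the
    transformations and one on the innovations in \<open>K\<close>.\<close>
  have steps: "(\<lambda>j\<in>J. X j \<omega>) = a \<longleftrightarrow> ?\<tau> \<omega> \<and> (\<forall>j\<in>K. g j \<omega> = a j)"
    and walk_eq: "(\<lambda>j\<in>J. X j \<omega>) = a \<Longrightarrow> walk G X n \<omega> = walk G ?Z n \<omega>"
    if \<omega>: "\<omega> \<in> space M" "config n \<omega> = c" for \<omega>
  proof -
    have cj: "\<xi> j \<omega> = fst (c j)" "u j \<omega> = snd (c j)" if "j \<in> {2..n}" for j
      using \<omega>(2) that config_eq_iff[OF c] by auto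
    have XK: "X j \<omega> = g j \<omega>" if "j \<in> {1..n}" "j = 1 \<or> \<not> fst (c j)" for j
      using that X_1[OF \<omega>(1)] X_rec[OF _ \<omega>(1), of j] cj[of j] by (cases "j = 1") auto
    have XR: "X j \<omega> = T j \<omega> (X (snd (c j)) \<omega>)" if "j \<in> R" for j
      using that X_rec[OF _ \<omega>(1), of j] cj[of j] by (auto simp: R_def)
    have KJ: "K \<subseteq> {1..n}" by (auto simp: K_def J_def)
    have ext: "(\<lambda>j\<in>J. X j \<omega>) = a \<longleftrightarrow> (\<forall>j\<in>J. X j \<omega> = a j)"
      using a unfolding J_def I_def by (rule restrict_eq_iff_of_PiE)
    show "(\<lambda>j\<in>J. X j \<omega>) = a \<longleftrightarrow> ?\<tau> \<omega> \<and> (\<forall>j\<in>K. g j \<omega> = a j)"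
    proof
      assume "(\<lambda>j\<in>J. X j \<omega>) = a"
      hence *: "X j \<omega> = a j" if "j \<in> J" for j using ext that by simp
      have "T j \<omega> (a (snd (c j))) = a j" if "j \<in> R" for j
        using XR[OF that] *[of j] *[of "snd (c j)"] RJ[OF that] that KR by auto
      moreover have "g j \<omega> = a j" if "j \<in> K" for j
        using XK[of j] *[of j] that KJ by (auto simp: K_def)
      ultimately show "?\<tau> \<omega> \<and> (\<forall>j\<in>K. g j \<omega> = a j)" by blast
    next
      assume *: "?\<tau> \<omega> \<and> (\<forall>j\<in>K. g j \<omega> = a j)"
      have "X j \<omega> = a j" if "j \<in> J" for j
        using that
      proof (induction j rule: less_induct)
        case (less j)
        show ?case
        proof (cases "j \<in> R")
          case True
          thus ?thesis using XR[OF True] less.IH RJ[OF True] * by simp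
        next
          case False
          hence jK: "j \<in> K" using less.prems KR by blast
          hence "j \<in> {1..n}" "j = 1 \<or> \<not> fst (c j)" using KJ by (auto simp: K_def)
          thus ?thesis using XK * jK by simp
        qed
      qed
      thus "(\<lambda>j\<in>J. X j \<omega>) = a" using ext by simp
    qed
    show "walk G X n \<omega> = walk G ?Z n \<omega>" if "(\<lambda>j\<in>J. X j \<omega>) = a"
    proof (rule walk_cong)
      fix j assume j: "1 \<le> j" "j \<le> n"
      show "X j \<omega> = ?Z j \<omega>"
      proof (cases "j \<in> I")
        case True
        thus ?thesis using XK[of j] by (auto simp: I_def isolated_def)
      next
        case False
        thus ?thesis using that ext j by (simp add: J_def)
      qed
    qed
  qed

  have finK: "finite K" "K \<subseteq> {1..}" "K \<inter> (I \<inter> {1..n}) = {}"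
    by (auto simp: K_def J_def)
  have R: "finite R" "R \<subseteq> {2..}" "\<And>j. j \<in> R \<Longrightarrow> a (snd (c j)) \<in> carrier G"
    using aJ RJ by (auto simp: R_def)
  define A where "A = {f\<in>space ?P. \<forall>j\<in>K. f j = a j}"
  define B where "B = {f\<in>space ?P. ?W f = x}"
  have A: "A \<in> sets ?P"
    unfolding A_def using finK by (intro sets_Collect_ball_eq_count_space[where S = "\<lambda>_. carrier G"] measurable_component_singleton) auto
  have "B \<in> sets ?P"
    unfolding B_def by (intro sets_Collect_eq_count_space[where S = "carrier G"] walk_coordinates_measurable countable aI) auto
  hence AB: "A \<inter> B \<in> sets ?P" using A by (rule_tac sets.Int)
  have sp: "(\<lambda>j\<in>{1..}. g j \<omega>) \<in> space ?P" if "\<omega> \<in> space M" for \<omega>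
    using measurable_space[OF g_measurable that] by (auto simp: space_PiM)
  have inA: "(\<lambda>j\<in>{1..}. g j \<omega>) \<in> A \<longleftrightarrow> (\<forall>j\<in>K. g j \<omega> = a j)" if "\<omega> \<in> space M" for \<omega>
    using sp[OF that] finK(2) by (auto simp: A_def)
  have inB: "(\<lambda>j\<in>{1..}. g j \<omega>) \<in> B \<longleftrightarrow> walk G ?Z n \<omega> = x" if "\<omega> \<in> space M" for \<omega>
  proof -
    have "?W (\<lambda>j\<in>{1..}. g j \<omega>) = walk G ?Z n \<omega>" by (intro walk_cong) auto
    thus ?thesis using sp[OF that] by (simp add: B_def)
  qed
  \<comment> \<open>The factor from the coins, memories and transformations; it is the same with and without the
    condition on the walk.\<close>
  define q where "q = prob {\<omega>\<in>space M. \<forall>j\<in>{2..n}. \<xi> j \<omega> = fst (c j)}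
      * prob {\<omega>\<in>space M. \<forall>j\<in>{2..n}. u j \<omega> = snd (c j)} * prob {\<omega>\<in>space M. ?\<tau> \<omega>}"
  have q: "0 \<le> q" by (simp add: q_def)
  have "{\<omega>\<in>space M. config n \<omega> = c \<and> (\<lambda>j\<in>J. X j \<omega>) = a}
      = {\<omega>\<in>space M. config n \<omega> = c \<and> ?\<tau> \<omega> \<and> (\<lambda>j\<in>{1..}. g j \<omega>) \<in> A}"
    by (intro Collect_cong) (metis steps inA)
  hence "prob {\<omega>\<in>space M. config n \<omega> = c \<and> (\<lambda>j\<in>J. X j \<omega>) = a}
      = q * prob {\<omega>\<in>space M. (\<lambda>j\<in>{1..}. g j \<omega>) \<in> A}"
    using prob_config_transformations_innovations[OF c R A, where k = a] by (simp only: q_def)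
  also have "{\<omega>\<in>space M. (\<lambda>j\<in>{1..}. g j \<omega>) \<in> A} = {\<omega>\<in>space M. \<forall>j\<in>K. g j \<omega> = a j}"
    using inA by blast
  finally have right: "prob {\<omega>\<in>space M. config n \<omega> = c \<and> (\<lambda>j\<in>J. X j \<omega>) = a}
      = q * prob {\<omega>\<in>space M. \<forall>j\<in>K. g j \<omega> = a j}"
    (is "_ = q * ?pK") .
  have "{\<omega>\<in>space M. walk G X n \<omega> = x \<and> config n \<omega> = c \<and> (\<lambda>j\<in>J. X j \<omega>) = a}
      = {\<omega>\<in>space M. config n \<omega> = c \<and> ?\<tau> \<omega> \<and> (\<lambda>j\<in>{1..}. g j \<omega>) \<in> A \<inter> B}"
  proof (intro Collect_cong)
    fix \<omega>
    show "(\<omega> \<in> space M \<and> walk G X n \<omega> = x \<and> config n \<omega> = c \<and> (\<lambda>j\<in>J. X j \<omega>) = a)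
      = (\<omega> \<in> space M \<and> config n \<omega> = c \<and> ?\<tau> \<omega> \<and> (\<lambda>j\<in>{1..}. g j \<omega>) \<in> A \<inter> B)"
    proof (cases "\<omega> \<in> space M \<and> config n \<omega> = c \<and> (\<lambda>j\<in>J. X j \<omega>) = a")
      case True
      hence \<omega>: "\<omega> \<in> space M" "config n \<omega> = c" "(\<lambda>j\<in>J. X j \<omega>) = a" by auto
      show ?thesis
        using steps[OF \<omega>(1,2)] walk_eq[OF \<omega>] inA[OF \<omega>(1)] inB[OF \<omega>(1)] \<omega>
        by (simp only: Int_iff) argo
    next
      case False
      thus ?thesis using steps[of \<omega>] inA[of \<omega>] by (simp only: Int_iff) argo
    qed
  qed
  hence "prob {\<omega>\<in>space M. walk G X n \<omega> = x \<and> config n \<omega> = c \<and> (\<lambda>j\<in>J. X j \<omega>) = a}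
      = q * prob {\<omega>\<in>space M. (\<lambda>j\<in>{1..}. g j \<omega>) \<in> A \<inter> B}"
    using prob_config_transformations_innovations[OF c R AB, where k = a] by (simp only: q_def)
  also have "{\<omega>\<in>space M. (\<lambda>j\<in>{1..}. g j \<omega>) \<in> A \<inter> B}
      = {\<omega>\<in>space M. (\<forall>j\<in>K. g j \<omega> = a j) \<and> walk G ?Z n \<omega> = x}"
    by (intro Collect_cong conj_cong refl) (simp only: Int_iff inA inB)
  also have "prob \<dots> = ?pK * prob {\<omega>\<in>space M. walk G ?Z n \<omega> = x}"
    by (rule prob_fixed_steps_and_walk[OF group_axioms countable indep_g aI finK])
  also have "q * (?pK * prob {\<omega>\<in>space M. walk G ?Z n \<omega> = x}) \<le> q * (?pK * \<epsilon>)"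
  proof -
    have "\<exists>d\<in>carrier G. \<forall>x\<in>carrier G. emeasure M {\<omega>\<in>space M. walk G ?Z n \<omega> = x}
        = conv_power G \<mu> (card (I \<inter> {1..n})) (x \<otimes> inv d)"
      by (rule walk_interspersed_law[OF group_axioms countable conj_inv indep_g distr_g aI])
    then obtain d where d: "d \<in> carrier G"
      and law: "\<forall>x\<in>carrier G. emeasure M {\<omega>\<in>space M. walk G ?Z n \<omega> = x}
        = conv_power G \<mu> (card (I \<inter> {1..n})) (x \<otimes> inv d)"
      by (rule bexE)
    have *: "emeasure M {\<omega>\<in>space M. walk G ?Z n \<omega> = x}
        = conv_power G \<mu> (card (I \<inter> {1..n})) (x \<otimes> inv d)"
      by (rule bspec[OF law x])
    have "I \<inter> {1..n} = I" using In by auto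
    hence "emeasure M {\<omega>\<in>space M. walk G ?Z n \<omega> = x} \<le> ennreal \<epsilon>"
      unfolding * using bound(1)[of "x \<otimes> inv d"] x d by (simp add: I_def)
    hence "prob {\<omega>\<in>space M. walk G ?Z n \<omega> = x} \<le> \<epsilon>"
      using bound(2) by (simp add: emeasure_eq_measure)
    thus ?thesis using q by (intro mult_left_mono) auto
  qed
  finally show ?thesis
    unfolding I_def[symmetric] J_def[symmetric] right by (simp only: mult_ac)
qed

text \<open>
  Partition according to the configuration and the steps that are not isolated innovations; as \<open>G\<close>
  is countable there are countably many cases. In those with at least \<open>m\<close> isolated innovations the
  conditional bound \<open>\<epsilon>\<close> applies, and the others are counted with their full probability.
\<close>
lemma walk_le_few_isolated:
  fixes \<epsilon> :: real
  assumes countable: "countable (carrier G)" and conj_inv: "class_function G \<mu>"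
    and bound: "\<And>k y. m \<le> k \<Longrightarrow> y \<in> carrier G \<Longrightarrow> conv_power G \<mu> k y \<le> ennreal \<epsilon>" "0 \<le> \<epsilon>"
    and n: "2 \<le> n" and x: "x \<in> carrier G"
  shows "prob {\<omega>\<in>space M. walk G X n \<omega> = x}
    \<le> \<epsilon> + (\<Sum>c\<in>{c\<in>configs n. card (isolated c n) < m}. config_weight \<alpha> n c)"
proof -
  define J where "J c = {1..n} - isolated c n" for c
  define K where "K = (SIGMA c:configs n. J c \<rightarrow>\<^sub>E carrier G)"
  define f where "f \<omega> = (config n \<omega>, \<lambda>j\<in>J (config n \<omega>). X j \<omega>)" for \<omega>
  let ?few = "{c\<in>configs n. card (isolated c n) < m}"
  let ?good = "\<lambda>\<omega>. walk G X n \<omega> = x \<and> m \<le> card (isolated (config n \<omega>) n)"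
  have Xc: "X j \<omega> \<in> carrier G" if "1 \<le> j" "\<omega> \<in> space M" for j \<omega>
    using measurable_space[OF step_measurable that(2)] that(1) by simp
  have config_sets: "{\<omega>\<in>space M. config n \<omega> = c} \<in> sets M" if "c \<in> configs n" for c
  proof -
    have "{\<omega>\<in>space M. \<forall>j\<in>{2..n}. \<xi> j \<omega> = fst (c j)} \<in> sets M"
         "{\<omega>\<in>space M. \<forall>j\<in>{2..n}. u j \<omega> = snd (c j)} \<in> sets M"
      by (intro sets_Collect_ball_eq_count_space[where S = "\<lambda>_. UNIV"]
            sets_Collect_ball_eq_count_space[where S = "\<lambda>j. {1..<j}"]
            coin_measurable memory_measurable; simp)+
    from sets.Int[OF this] show ?thesis
      by (rule back_subst[of "\<lambda>A. A \<in> sets M"]) (auto simp: config_eq_iff[OF that])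
  qed
  have walk_sets: "{\<omega>\<in>space M. walk G X n \<omega> = x} \<in> sets M"
    by (intro sets_Collect_eq_count_space[where S = "carrier G"] walk_measurable countable step_measurable)
  have f_sets: "{\<omega>\<in>space M. f \<omega> = (c, a)} \<in> sets M" if "(c, a) \<in> K" for c a
  proof -
    have c: "c \<in> configs n" and a: "a \<in> J c \<rightarrow>\<^sub>E carrier G" using that by (auto simp: K_def)
    have "{\<omega>\<in>space M. \<forall>j\<in>J c. X j \<omega> = a j} \<in> sets M"
      by (intro sets_Collect_ball_eq_count_space[where S = "\<lambda>_. carrier G"] step_measurable) (auto simp: J_def)
    from sets.Int[OF config_sets[OF c] this] show ?thesis
    proof (rule back_subst[of "\<lambda>A. A \<in> sets M"])
      have "(\<lambda>j\<in>J c. X j \<omega>) = a \<longleftrightarrow> (\<forall>j\<in>J c. X j \<omega> = a j)" for \<omega>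
        using a by (rule restrict_eq_iff_of_PiE)
      thus "{\<omega>\<in>space M. config n \<omega> = c} \<inter> {\<omega>\<in>space M. \<forall>j\<in>J c. X j \<omega> = a j}
          = {\<omega>\<in>space M. f \<omega> = (c, a)}"
        by (auto simp: f_def)
    qed
  qed
  have "prob {\<omega>\<in>space M. ?good \<omega>} \<le> \<epsilon> * prob {\<omega>\<in>space M. True}"
  proof (rule measure_le_by_partition[where f = f and K = K])
    show "countable K"
      unfolding K_def by (intro countable_SIGMA countable_finite[OF finite_configs] countable_PiE)
        (auto simp: J_def countable)
    show "f \<omega> \<in> K" if "\<omega> \<in> space M" for \<omega>
      using config_in_configs[OF that] Xc[OF _ that] by (auto simp: f_def K_def J_def)
    fix k assume k: "k \<in> K"
    obtain c a where ca: "k = (c, a)" by (cases k)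
    have c: "c \<in> configs n" and a: "a \<in> J c \<rightarrow>\<^sub>E carrier G" using k by (auto simp: K_def ca)
    show Q: "{\<omega>\<in>space M. True \<and> f \<omega> = k} \<in> sets M" using f_sets k by (simp add: ca)
    have good: "{\<omega>\<in>space M. ?good \<omega> \<and> f \<omega> = k} = (if m \<le> card (isolated c n)
      then {\<omega>\<in>space M. walk G X n \<omega> = x} \<inter> {\<omega>\<in>space M. f \<omega> = (c, a)} else {})"
      by (auto simp: ca f_def)
    show "{\<omega>\<in>space M. ?good \<omega> \<and> f \<omega> = k} \<in> sets M"
      unfolding good using walk_sets f_sets k by (auto simp: ca)
    show "prob {\<omega>\<in>space M. ?good \<omega> \<and> f \<omega> = k} \<le> \<epsilon> * prob {\<omega>\<in>space M. True \<and> f \<omega> = k}"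
    proof (cases "m \<le> card (isolated c n)")
      case True
      have "{\<omega>\<in>space M. ?good \<omega> \<and> f \<omega> = k} = {\<omega>\<in>space M. walk G X n \<omega> = x \<and> config n \<omega> = c
          \<and> (\<lambda>j\<in>{1..n} - isolated c n. X j \<omega>) = a}"
        using True by (auto simp: ca f_def J_def)
      moreover have "{\<omega>\<in>space M. True \<and> f \<omega> = k} = {\<omega>\<in>space M. config n \<omega> = c
          \<and> (\<lambda>j\<in>{1..n} - isolated c n. X j \<omega>) = a}"
        by (auto simp: ca f_def J_def)
      ultimately show ?thesis
        using walk_given_steps_le[OF countable conj_inv bound(1)[OF True] bound(2) c a[unfolded J_def] x]
        by simp
    next
      case False
      hence "{\<omega>\<in>space M. ?good \<omega> \<and> f \<omega> = k} = {}" unfolding good by (rule if_not_P)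
      thus ?thesis using bound(2) by (simp only: measure_empty) simp
    qed
  qed (rule bound)
  hence good: "prob {\<omega>\<in>space M. ?good \<omega>} \<le> \<epsilon>" by (simp add: prob_space)
  have few: "(\<Union>c\<in>?few. {\<omega>\<in>space M. config n \<omega> = c}) \<in> sets M"
    by (intro sets.finite_UN) (auto simp: finite_configs config_sets)
  have "prob (\<Union>c\<in>?few. {\<omega>\<in>space M. config n \<omega> = c})
      \<le> (\<Sum>c\<in>?few. prob {\<omega>\<in>space M. config n \<omega> = c})"
    by (intro finite_measure_subadditive_finite) (auto simp: finite_configs config_sets)
  also have "\<dots> = (\<Sum>c\<in>?few. config_weight \<alpha> n c)"
    by (intro sum.cong prob_config n) auto
  finally have bad: "prob (\<Union>c\<in>?few. {\<omega>\<in>space M. config n \<omega> = c}) \<le> \<dots>" .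
  have split: "{\<omega>\<in>space M. ?good \<omega>} =
      {\<omega>\<in>space M. walk G X n \<omega> = x} - (\<Union>c\<in>?few. {\<omega>\<in>space M. config n \<omega> = c})"
    using config_in_configs by auto
  have "{\<omega>\<in>space M. ?good \<omega>} \<in> sets M" unfolding split by (intro sets.Diff walk_sets few)
  hence 1: "prob ({\<omega>\<in>space M. ?good \<omega>} \<union> (\<Union>c\<in>?few. {\<omega>\<in>space M. config n \<omega> = c}))
      \<le> prob {\<omega>\<in>space M. ?good \<omega>} + prob (\<Union>c\<in>?few. {\<omega>\<in>space M. config n \<omega> = c})"
    and 2: "{\<omega>\<in>space M. ?good \<omega>} \<union> (\<Union>c\<in>?few. {\<omega>\<in>space M. config n \<omega> = c}) \<in> sets M"
    using few by (auto intro: measure_subadditive)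
  have "prob {\<omega>\<in>space M. walk G X n \<omega> = x}
      \<le> prob ({\<omega>\<in>space M. ?good \<omega>} \<union> (\<Union>c\<in>?few. {\<omega>\<in>space M. config n \<omega> = c}))"
    unfolding split by (rule finite_measure_mono[OF _ 2[unfolded split]]) blast
  also note 1
  finally have "prob {\<omega>\<in>space M. walk G X n \<omega> = x}
      \<le> prob {\<omega>\<in>space M. ?good \<omega>} + prob (\<Union>c\<in>?few. {\<omega>\<in>space M. config n \<omega> = c})" .
  thus ?thesis using good bad by linarith
qed

lemma unreinforced_walk_AE:
  assumes "\<alpha> = 0"
  shows "AE \<omega> in M. walk G X n \<omega> = walk G g n \<omega>"
proof -
  have "AE \<omega> in M. \<forall>j\<in>{2..n}. \<not> \<xi> j \<omega>"
  proof (rule AE_finite_allI)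
    fix j assume "j \<in> {2..n}"
    hence j: "2 \<le> j" by simp
    have "prob (\<xi> j -` {True} \<inter> space M) = 0" using prob_coin[OF j, of True] assms by simp
    hence "\<xi> j -` {True} \<inter> space M \<in> null_sets M"
      using measurable_sets[OF coin_measurable[OF j], of "{True}"]
      by (simp add: null_setsI emeasure_eq_measure)
    thus "AE \<omega> in M. \<not> \<xi> j \<omega>" by (rule AE_I') auto
  qed simp
  thus ?thesis
  proof (rule AE_mp, intro AE_I2 impI walk_cong)
    fix \<omega> j assume "\<omega> \<in> space M" "\<forall>j\<in>{2..n}. \<not> \<xi> j \<omega>" "1 \<le> j" "j \<le> n"
    thus "X j \<omega> = g j \<omega>" using X_1 X_rec[of j \<omega>] by (cases "j = 1") auto
  qed
qed

text \<open>
  For \<open>\<alpha> = 0\<close> the walk is almost surely the product of the innovations, so that its law is that of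
  \<open>walk_interspersed_law\<close> without constant steps. That lemma determines the law up to a translation,
  which does not affect a bound that is uniform in the point.
\<close>
lemma conv_power_le_unreinforced:
  fixes \<epsilon> :: real
  assumes "\<alpha> = 0" and countable: "countable (carrier G)" and conj_inv: "class_function G \<mu>"
    and bound: "\<And>x. x \<in> carrier G \<Longrightarrow> prob {\<omega>\<in>space M. walk G X k \<omega> = x} \<le> \<epsilon>"
    and y: "y \<in> carrier G"
  shows "conv_power G \<mu> k y \<le> ennreal \<epsilon>"
proof -
  obtain d where d: "d \<in> carrier G" and *: "\<And>x. x \<in> carrier G \<Longrightarrow>
      emeasure M {\<omega>\<in>space M. walk G g k \<omega> = x} = conv_power G \<mu> k (x \<otimes> inv d)"
    using walk_interspersed_law[OF group_axioms countable conj_inv indep_g distr_g, of k UNIV]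
    by auto
  have "conv_power G \<mu> k y = emeasure M {\<omega>\<in>space M. walk G g k \<omega> = y \<otimes> d}"
    using *[of "y \<otimes> d"] y d by (simp add: m_assoc)
  also have "\<dots> = emeasure M {\<omega>\<in>space M. walk G X k \<omega> = y \<otimes> d}"
  proof (rule emeasure_eq_AE)
    show "AE \<omega> in M. \<omega> \<in> {\<omega>\<in>space M. walk G g k \<omega> = y \<otimes> d}
        \<longleftrightarrow> \<omega> \<in> {\<omega>\<in>space M. walk G X k \<omega> = y \<otimes> d}"
      using unreinforced_walk_AE[OF assms(1), of k] by eventually_elim auto
    show "{\<omega>\<in>space M. walk G g k \<omega> = y \<otimes> d} \<in> sets M"
      by (intro sets_Collect_eq_count_space[where S = "carrier G"] walk_measurable countable g_measurable)
    show "{\<omega>\<in>space M. walk G X k \<omega> = y \<otimes> d} \<in> sets M"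
      by (intro sets_Collect_eq_count_space[where S = "carrier G"] walk_measurable countable step_measurable)
  qed
  also have "\<dots> \<le> ennreal \<epsilon>"
    using bound[of "y \<otimes> d"] y d by (simp add: emeasure_eq_measure ennreal_leI)
  finally show ?thesis .
qed

end

theorem proposition1p2:
  fixes G :: "('a, 'b) monoid_scheme"
    and \<mu> :: "'a measure"
    and M :: "'w measure" and M0 :: "'v measure"
    and \<alpha> \<epsilon> :: real and m :: nat
  assumes "countable (carrier G)" and "infinite (carrier G)"
    and "srrw M G \<mu> \<alpha> g \<xi> u T X" and "\<alpha> < 1"
    and "class_function G \<mu>"
    and "srrw M0 G \<mu> 0 g0 \<xi>0 u0 T0 X0"
    and "0 < \<epsilon>" and "\<epsilon> < 1" and "1 \<le> m"
    and "\<forall>n\<ge>m. \<forall>x\<in>carrier G. \<P>(\<omega> in M0. walk G X0 n \<omega> = x) \<le> \<epsilon>"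
  shows "\<forall>n::nat. real n \<ge> 8 * real m / (1 - \<alpha>) \<longrightarrow>
    (\<forall>x\<in>carrier G. \<P>(\<omega> in M. walk G X n \<omega> = x)
       \<le> \<epsilon> + 2 * exp (- (1 - \<alpha>) * real n / 18))"
proof (intro allI impI ballI)
  fix n :: nat and x assume n: "8 * real m / (1 - \<alpha>) \<le> real n" and x: "x \<in> carrier G"
  interpret S: srrw M G \<mu> \<alpha> g \<xi> u T X by (fact assms(3))
  interpret S0: srrw M0 G \<mu> 0 g0 \<xi>0 u0 T0 X0 by (fact assms(6))
  have \<alpha>: "0 \<le> \<alpha>" by (rule S.alpha)
  have "8 * real m \<le> (1 - \<alpha>) * real n" using n assms(4) by (simp add: field_simps)
  also have "\<dots> \<le> 1 * real n" using \<alpha> by (intro mult_right_mono) auto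
  finally have n2: "2 \<le> n" using assms(9) by simp
  have bound: "conv_power G \<mu> k y \<le> ennreal \<epsilon>" if "m \<le> k" "y \<in> carrier G" for k y
    using S0.conv_power_le_unreinforced[OF refl assms(1,5), of k \<epsilon> y] assms(10) that by simp
  have "\<P>(\<omega> in M. walk G X n \<omega> = x)
      \<le> \<epsilon> + (\<Sum>c\<in>{c\<in>configs n. card (isolated c n) < m}. config_weight \<alpha> n c)"
    using S.walk_le_few_isolated[OF assms(1,5) bound _ n2 x] assms(7) by simp
  also have "\<dots> \<le> \<epsilon> + exp (- (1 - \<alpha>) * real n / 18)"
    using weight_few_isolated_le[OF \<alpha> assms(4,9) n] by simp
  also have "\<dots> \<le> \<epsilon> + 2 * exp (- (1 - \<alpha>) * real n / 18)"
    by simp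
  finally show "\<P>(\<omega> in M. walk G X n \<omega> = x) \<le> \<epsilon> + 2 * exp (- (1 - \<alpha>) * real n / 18)" .
qed

end
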